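(* Assume the stability condition, condition (C), $\rho_1\ne\rho_2$, Assumption (E), and the span condition (S) of the context. Then there is a vector $\bm b_{2,1}\in\mathbb R^{|\mathcal M|}$ such that the function $$\mathfrak h_{\rho_2}\doteq[(\rho_2,1,\bm d_2),\cdot]+\sum_{j=1}^{|\mathcal M|}\bm b_{2,1}(j)\,[(\rho_2,\alpha_j^*,\bm d_{2,j}),\cdot]$$ is $(Y,M)$-harmonic and $\partial B$-determined.
   Context: Setting: $\mathcal M$ is a finite set, $\bm P$ an irreducible aperiodic transition matrix on $\mathcal M$ with stationary distribution $\bm\pi$; for each $m\in\mathcal M$, $\lambda(m),\mu_1(m),\mu_2(m)>0$ and $\lambda(m)+\mu_1(m)+\mu_2(m)=1$. $(Y,M)$ is the Markov chain on $\mathbb Z\times\mathbb Z_+\times\mathcal M$ which from $(y,m)$ moves to $(y,m')$ with probability $\bm P(m,m')$ for each $m'\neq m$, and with probability $\bm P(m,m)$ keeps $m$ and attempts an increment $v\in\{(-1,0),(1,1),(0,-1)\}$, chosen with respective probabilities $\lambda(m),\mu_1(m),\mu_2(m)$: it moves to $(y+v,m)$ if $y+v\in\mathbb Z\times\mathbb Z_+$ and otherwise stays. A function $h$ on $\mathbb Z\times\mathbb Z_+\times\mathcal M$ is $(Y,M)$-harmonic if $\mathbb E_{(y,m)}[h(Y_1,M_1)]=h(y,m)$ for all $(y,m)$. $B=\{y\in\mathbb Z\times\mathbb Z_+:y(1)\ge y(2)\}$, $\partial B=\{y\in\mathbb Z\times\mathbb Z_+:y(1)=y(2)\}$, $\tau=\inf\{k\ge0:Y_k\in\partial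 B\}$. A harmonic $h$ is $\partial B$-determined if for some function $f$, $h(y,m)=\mathbb E_{(y,m)}[f(Y_\tau,M_\tau)1_{\{\tau<\infty\}}]$ for all $(y,m)\in B\times\mathcal M$. $[(\beta,\alpha,\bm d),(y,m)]=\beta^{y(1)-y(2)}\alpha^{y(2)}\bm d(m)$. $\bm A(\beta,\alpha)$ is the $\mathcal M\times\mathcal M$ matrix with off-diagonal entries $\bm P(m_1,m_2)$ and diagonal entries $\bm P(m,m)\big(\lambda(m)/\beta+\mu_1(m)\alpha+\mu_2(m)\beta/\alpha\big)$; for $\beta,\alpha>0$, $\Lambda_1(\beta,\alpha)$ is its largest (Perron–Frobenius) eigenvalue. $\bm c(\beta,\alpha,\bm d)\in\mathbb C^{\mathcal M}$ is defined by $\bm c(\beta,\alpha,\bm d)(m)=\bm P(m,m)\mu_2(m)\bm d(m)(1-\beta/\alpha)$. Stability condition: $\sum_{m}(\lambda(m)-\mu_i(m))\bm\pi(m)\bm P(m,m)<0$, $i=1,2$. Under it $\rho_1$ is the unique number in $(0,1)$ with $\Lambda_1(\rho_1,\rho_1)=1$, and $\rho_2$ the unique number in $(0,1)$ with $\Lambda_1(\rho_2,1)=1$; $\bm d_2$ is an eigenvector of $\bm A(\rho_2,1)$ for the eigenvalue $1$ with strictly positive entries. Condition (C): $\sum_{m}(\rho_2\mu_2(m)-\mu_1(m))\bm P(m,m)\det\big((\bm I-\bm A(\rho_2,1))^{m,m}\big)<0$, where $G^{m,m}$ is $G$ with row and column $m$ removed. Under it there is a unique $\alpha_1^*\in(0,1)$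 with $\Lambda_1(\rho_2,\alpha_1^* )=1$. Assumption (E): for all $\beta,\alpha>0$ the matrix $\bm A(\beta,\alpha)$ has $|\mathcal M|$ distinct real eigenvalues, labelled $\Lambda_1>\Lambda_2>\dots>\Lambda_{|\mathcal M|}$. For $j=2,\dots,|\mathcal M|$, $\alpha_j^*\in(0,\alpha_1^* )$ is a number with $\Lambda_j(\rho_2,\alpha_j^* )=1$; for $j=1,\dots,|\mathcal M|$, $\bm d_{2,j}\in\mathbb R^{\mathcal M}\setminus\{0\}$ satisfies $\bm A(\rho_2,\alpha_j^* )\bm d_{2,j}=\bm d_{2,j}$. Span condition (S): $\bm c(\rho_2,1,\bm d_2)\in\mathrm{Span}\big(\bm c(\rho_2,\alpha_j^*,\bm d_{2,j}):j=1,\dots,|\mathcal M|\big)$. *)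

theory Defs
  imports "HOL-Probability.Probability"
begin

definition stochastic_matrix :: "real^'m^'m \<Rightarrow> bool" where
  "stochastic_matrix P \<longleftrightarrow> (\<forall>m m'. 0 \<le> P $ m $ m') \<and> (\<forall>m. (\<Sum>m'\<in>UNIV. P $ m $ m') = 1)"

text \<open>The operator \<open>^\<close> on \<open>real^'m^'m\<close> is the componentwise power, so the
  \<open>n\<close>-step transition matrix is written with an iterated matrix product.\<close>

definition matrix_pow :: "real^'m^'m \<Rightarrow> nat \<Rightarrow> real^'m^'m" where
  "matrix_pow P n = (((**) P) ^^ n) (mat 1)"

definition irreducible_matrix :: "real^'m^'m \<Rightarrow> bool" where
  "irreducible_matrix P \<longleftrightarrow> (\<forall>m m'. \<exists>n. matrix_pow P n $ m $ m' > 0)"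

definition aperiodic_matrix :: "real^'m^'m \<Rightarrow> bool" where
  "aperiodic_matrix P \<longleftrightarrow> (\<forall>m. Gcd {n. n > 0 \<and> matrix_pow P n $ m $ m > 0} = (1::nat))"

definition stationary_distribution :: "real^'m^'m \<Rightarrow> real^'m \<Rightarrow> bool" where
  "stationary_distribution P p \<longleftrightarrow>
     (\<forall>m. 0 \<le> p $ m) \<and> (\<Sum>m\<in>UNIV. p $ m) = 1 \<and> p v* P = p"

text \<open>A state \<open>((y1, y2), m)\<close> is a point of \<open>\<int> \<times> \<int>\<^sub>+ \<times> M\<close>.\<close>

type_synonym 'm state = "(int \<times> nat) \<times> 'm"

fun try_move :: "int \<times> nat \<Rightarrow> int \<times> int \<Rightarrow> int \<times> nat" where
  "try_move (y1, y2) (v1, v2) =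
     (if int y2 + v2 \<ge> 0 then (y1 + v1, nat (int y2 + v2)) else (y1, y2))"

definition increment_pmf ::
  "('m \<Rightarrow> real) \<Rightarrow> ('m \<Rightarrow> real) \<Rightarrow> ('m \<Rightarrow> real) \<Rightarrow> 'm \<Rightarrow> (int \<times> int) pmf" where
  "increment_pmf lam mu1 mu2 m =
     pmf_of_list [((-1, 0), lam m), ((1, 1), mu1 m), ((0, -1), mu2 m)]"

definition walk_kernel ::
  "real^'m^'m \<Rightarrow> ('m \<Rightarrow> real) \<Rightarrow> ('m \<Rightarrow> real) \<Rightarrow> ('m \<Rightarrow> real) \<Rightarrow> 'm state \<Rightarrow> 'm state pmf" where
  "walk_kernel P lam mu1 mu2 = (\<lambda>(y, m).
     bind_pmf (embed_pmf (\<lambda>m'. P $ m $ m')) (\<lambda>m'.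
       if m' \<noteq> m then return_pmf (y, m')
       else map_pmf (\<lambda>v. (try_move y v, m)) (increment_pmf lam mu1 mu2 m)))"

text \<open>Law of the trajectory \<open>(X\<^sub>0, X\<^sub>1, \<dots>)\<close> of the Markov chain with kernel \<open>K\<close> and \<open>X\<^sub>0 = s\<close>:
  the Ionescu-Tulcea measure on sequences whose conditional law of \<open>X\<^sub>n\<close> given
  \<open>X\<^sub>0, \<dots>, X\<^sub>n\<^sub>-\<^sub>1\<close> is \<open>path_step K s n\<close>.\<close>

definition path_step :: "('s \<Rightarrow> 's pmf) \<Rightarrow> 's \<Rightarrow> nat \<Rightarrow> (nat \<Rightarrow> 's) \<Rightarrow> 's measure" where
  "path_step K s n \<omega> = measure_pmf (case n of 0 \<Rightarrow> return_pmf s | Suc k \<Rightarrow> K (\<omega> k))"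

definition path_measure :: "('s \<Rightarrow> 's pmf) \<Rightarrow> 's \<Rightarrow> (nat \<Rightarrow> 's) measure" where
  "path_measure K s =
     projective_family.lim UNIV
       (Ionescu_Tulcea.CI (path_step K s) (\<lambda>_. count_space UNIV)) (\<lambda>_. count_space UNIV)"

lemma Ionescu_Tulcea_path_step:
  "Ionescu_Tulcea (path_step K s) (\<lambda>_. count_space UNIV)"
proof (rule Ionescu_Tulcea.intro)
  fix i
  show "path_step K s i \<in> measurable (PiM {0..<i} (\<lambda>_. count_space UNIV))
          (subprob_algebra (count_space UNIV))"
  proof (cases i)
    case 0
    have "path_step K s 0 = (\<lambda>_. measure_pmf (return_pmf s))"
      by (simp add: path_step_def fun_eq_iff)
    then show ?thesis
      unfolding 0 by (simp add: measure_pmf_in_subprob_algebra)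
  next
    case (Suc k)
    have "(\<lambda>\<omega>. \<omega> k) \<in> measurable (PiM {0..<i} (\<lambda>_. count_space UNIV)) (count_space UNIV)"
      using Suc by (intro measurable_component_singleton) auto
    moreover have "(\<lambda>x. measure_pmf (K x)) \<in>
        measurable (count_space UNIV) (subprob_algebra (count_space UNIV))"
      by (simp add: measure_pmf_in_subprob_algebra)
    ultimately have "(\<lambda>\<omega>. measure_pmf (K (\<omega> k))) \<in>
        measurable (PiM {0..<i} (\<lambda>_. count_space UNIV)) (subprob_algebra (count_space UNIV))"
      by (rule measurable_compose)
    moreover have "path_step K s i = (\<lambda>\<omega>. measure_pmf (K (\<omega> k)))"
      by (simp add: path_step_def fun_eq_iff Suc)
    ultimately show ?thesis by simp
  qed
next
  show "prob_space (path_step K s i x)" for i x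
    by (simp add: path_step_def measure_pmf.prob_space_axioms)
qed

definition harmonic :: "('s \<Rightarrow> 's pmf) \<Rightarrow> ('s \<Rightarrow> real) \<Rightarrow> bool" where
  "harmonic K h \<longleftrightarrow> (\<forall>s. integrable (path_measure K s) (\<lambda>\<omega>. h (\<omega> 1)) \<and>
     (\<integral>\<omega>. h (\<omega> 1) \<partial>path_measure K s) = h s)"

definition B_region :: "(int \<times> nat) set" where
  "B_region = {y. fst y \<ge> int (snd y)}"

definition B_boundary :: "(int \<times> nat) set" where
  "B_boundary = {y. fst y = int (snd y)}"

definition hit_time :: "(nat \<Rightarrow> 'm state) \<Rightarrow> enat" where
  "hit_time \<omega> = Inf (enat ` {k. fst (\<omega> k) \<in> B_boundary})"

text \<open>The integrability clause makes the expectation genuine; the Bochner integral of a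
  non-integrable function is \<open>0\<close> by convention.\<close>

definition boundary_determined :: "('m state \<Rightarrow> 'm state pmf) \<Rightarrow> ('m state \<Rightarrow> real) \<Rightarrow> bool" where
  "boundary_determined K h \<longleftrightarrow> (\<exists>f::'m state \<Rightarrow> real. \<forall>y m. y \<in> B_region \<longrightarrow>
     (let g = (\<lambda>\<omega>. f (\<omega> (the_enat (hit_time \<omega>))) * indicator {\<omega>. hit_time \<omega> < \<infinity>} \<omega>)
      in integrable (path_measure K (y, m)) g \<and>
         h (y, m) = (\<integral>\<omega>. g \<omega> \<partial>path_measure K (y, m))))"

definition char_matrix ::
  "real^'m^'m \<Rightarrow> ('m \<Rightarrow> real) \<Rightarrow> ('m \<Rightarrow> real) \<Rightarrow> ('m \<Rightarrow> real) \<Rightarrow> real \<Rightarrow> real \<Rightarrow> real^'m^'m" where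
  "char_matrix P lam mu1 mu2 \<beta> \<alpha> = (\<chi> m m'.
     if m = m' then P $ m $ m * (lam m / \<beta> + mu1 m * \<alpha> + mu2 m * \<beta> / \<alpha>) else P $ m $ m')"

definition real_eigenvalues :: "real^'m^'m \<Rightarrow> real set" where
  "real_eigenvalues A = {x. \<exists>v. v \<noteq> 0 \<and> A *v v = x *s v}"

text \<open>\<open>eigenvalue_nr A j\<close> is the \<open>j\<close>-th largest real eigenvalue of \<open>A\<close>, counted from \<open>j = 1\<close> and
  without multiplicity. For an irreducible nonnegative matrix the Perron-Frobenius eigenvalue
  is real and is the largest one, hence \<open>eigenvalue_nr A 1\<close>.\<close>

definition eigenvalue_nr :: "real^'m^'m \<Rightarrow> nat \<Rightarrow> real" where
  "eigenvalue_nr A j = rev (sorted_list_of_set (real_eigenvalues A)) ! (j - 1)"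

lemma eigenvalue_nr_1_eq_Max:
  assumes "finite (real_eigenvalues A)" "real_eigenvalues A \<noteq> {}"
  shows "eigenvalue_nr A 1 = Max (real_eigenvalues A)"
proof -
  let ?l = "sorted_list_of_set (real_eigenvalues A)"
  have ne: "?l \<noteq> []" using assms by simp
  have "eigenvalue_nr A 1 = last ?l"
    using ne by (simp add: eigenvalue_nr_def hd_rev flip: hd_conv_nth)
  moreover have "Max (set ?l) = last ?l"
  proof (rule Max_eqI)
    show "y \<le> last ?l" if "y \<in> set ?l" for y
    proof -
      from that obtain i where "i < length ?l" "y = ?l ! i" by (metis in_set_conv_nth)
      then show ?thesis
        using ne by (auto simp: last_conv_nth simp del: length_sorted_list_of_set
            intro!: sorted_nth_mono)
    qed
  qed (simp_all only: finite_set last_in_set[OF ne])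
  ultimately show ?thesis using assms by simp
qed

definition Lambda ::
  "nat \<Rightarrow> real^'m^'m \<Rightarrow> ('m \<Rightarrow> real) \<Rightarrow> ('m \<Rightarrow> real) \<Rightarrow> ('m \<Rightarrow> real) \<Rightarrow> real \<Rightarrow> real \<Rightarrow> real" where
  "Lambda j P lam mu1 mu2 \<beta> \<alpha> = eigenvalue_nr (char_matrix P lam mu1 mu2 \<beta> \<alpha>) j"

definition distinct_real_eigenvalues ::
  "real^'m^'m \<Rightarrow> ('m \<Rightarrow> real) \<Rightarrow> ('m \<Rightarrow> real) \<Rightarrow> ('m \<Rightarrow> real) \<Rightarrow> bool" where
  "distinct_real_eigenvalues P lam mu1 mu2 \<longleftrightarrow>
     (\<forall>\<beta> \<alpha>. \<beta> > 0 \<longrightarrow> \<alpha> > 0 \<longrightarrow>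
        card (real_eigenvalues (char_matrix P lam mu1 mu2 \<beta> \<alpha>)) = CARD('m::finite))"

definition stability_condition ::
  "real^'m^'m \<Rightarrow> real^'m \<Rightarrow> ('m \<Rightarrow> real) \<Rightarrow> ('m \<Rightarrow> real) \<Rightarrow> ('m \<Rightarrow> real) \<Rightarrow> bool" where
  "stability_condition P p lam mu1 mu2 \<longleftrightarrow>
     (\<Sum>m\<in>UNIV. (lam m - mu1 m) * p $ m * P $ m $ m) < 0 \<and>
     (\<Sum>m\<in>UNIV. (lam m - mu2 m) * p $ m * P $ m $ m) < 0"

text \<open>\<open>principal_det S G\<close> is the determinant of the submatrix of \<open>G\<close> with rows and columns
  in \<open>S\<close>, by the Leibniz formula that defines \<open>det\<close>. In particular \<open>principal_det (- {m}) G\<close> is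
  the determinant of \<open>G\<close> with row and column \<open>m\<close> removed, and it is \<open>1\<close> if no row is left.\<close>

definition principal_det :: "'m set \<Rightarrow> real^'m^'m \<Rightarrow> real" where
  "principal_det S G =
     (\<Sum>p | p permutes S. of_int (sign p) * (\<Prod>i\<in>S. G $ i $ p i))"

lemma principal_det_UNIV: "principal_det UNIV G = det G"
  by (simp add: principal_det_def det_def)

definition determinant_condition ::
  "real^'m^'m \<Rightarrow> ('m \<Rightarrow> real) \<Rightarrow> ('m \<Rightarrow> real) \<Rightarrow> ('m \<Rightarrow> real) \<Rightarrow> real \<Rightarrow> bool" where
  "determinant_condition P lam mu1 mu2 \<rho>2 \<longleftrightarrow>
     (\<Sum>m\<in>UNIV. (\<rho>2 * mu2 m - mu1 m) * P $ m $ m *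
        principal_det (- {m}) (mat 1 - char_matrix P lam mu1 mu2 \<rho>2 1)) < 0"

definition expfun :: "real \<Rightarrow> real \<Rightarrow> real^'m \<Rightarrow> 'm state \<Rightarrow> real" where
  "expfun \<beta> \<alpha> d = (\<lambda>((y1, y2), m). \<beta> powi (y1 - int y2) * \<alpha> ^ y2 * d $ m)"

definition cvec :: "real^'m \<Rightarrow> complex^'m" where
  "cvec d = (\<chi> m. complex_of_real (d $ m))"

definition boundary_vec ::
  "real^'m^'m \<Rightarrow> ('m \<Rightarrow> real) \<Rightarrow> complex \<Rightarrow> complex \<Rightarrow> complex^'m \<Rightarrow> complex^'m" where
  "boundary_vec P mu2 \<beta> \<alpha> d =
     (\<chi> m. of_real (P $ m $ m) * of_real (mu2 m) * d $ m * (1 - \<beta> / \<alpha>))"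

end

theory Submission
  imports Defs
begin

text \<open>
  Each exponential term is harmonic away from \<open>y\<^sub>2 = 0\<close>, because \<open>d\<close> is an eigenvector of the
  characteristic matrix for the eigenvalue 1; at \<open>y\<^sub>2 = 0\<close> the defect is \<open>\<beta>\<close> to the power \<open>y\<^sub>1\<close>
  times the boundary vector, and since all terms share \<open>\<beta> = \<rho>\<^sub>2\<close>, the span condition lets the
  defects cancel (with the real parts of the complex coefficients).

  On \<open>B\<close> the resulting \<open>h\<close> is bounded by a multiple of \<open>\<rho>\<^sub>2\<close> to the power \<open>y\<^sub>1 - y\<^sub>2\<close>, since the
  \<open>\<alpha>\<close>'s are at most 1. By optional stopping, \<open>h\<close> is determined by its values on the diagonal
  \<open>\<partial>B\<close> as soon as the expectation of \<open>\<bar>h\<bar>\<close> over \<open>{\<tau> > n}\<close> tends to 0. Now \<open>\<bar>h\<bar> \<ge> e\<close>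
  bounds the distance \<open>y\<^sub>1 - y\<^sub>2\<close> to the diagonal, so from such a state the walk hits the diagonal
  within \<open>N\<close> steps with probability at least \<open>\<delta> > 0\<close>, uniformly in the state. Hence the
  probability of \<open>{\<tau> > n, \<bar>h\<bar> \<ge> e}\<close> at time \<open>n\<close> is at most that of \<open>{n < \<tau> \<le> n + N}\<close>
  divided by \<open>\<delta>\<close>, which tends to 0.
\<close>

section \<open>Paths of a Markov chain\<close>

lemma sets_path_measure [measurable_cong]:
  "sets (path_measure K s) = sets (PiM UNIV (\<lambda>_. count_space UNIV))"
proof -
  interpret Ionescu_Tulcea "path_step K s" "\<lambda>_. count_space UNIV"
    by (rule Ionescu_Tulcea_path_step)
  show ?thesis unfolding path_measure_def by (rule PF.sets_lim)
qed

lemma space_path_measure [simp]: "space (path_measure K s) = UNIV"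
  using sets_eq_imp_space_eq[OF sets_path_measure, of K s] by (simp add: space_PiM)

text \<open>The projective limit has the marginals \<open>CI\<close>, and on an initial segment
  these are the iterated kernels \<open>C 0 n\<close>. Integrals over finitely many coordinates thus
  become integrals over finitely many steps.\<close>

lemma integral_path_measure_restrict:
  fixes f :: "(nat \<Rightarrow> 's) \<Rightarrow> real"
  assumes f: "f \<in> borel_measurable (PiM {0..<n} (\<lambda>_. count_space UNIV))"
  shows "(\<integral>\<omega>. f (restrict \<omega> {0..<n}) \<partial>path_measure K s) =
    (\<integral>x. f x \<partial>Ionescu_Tulcea.C (path_step K s) (\<lambda>_. count_space UNIV) 0 n (\<lambda>_. undefined))"
proof -
  interpret Ionescu_Tulcea "path_step K s" "\<lambda>_. count_space UNIV"
    by (rule Ionescu_Tulcea_path_step)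
  \<comment> \<open>\<open>CI J\<close> is built from the shortest initial segment that contains
    \<open>J\<close>; for \<open>{0..<n}\<close> this is the set itself.\<close>
  have up: "up_to {0..<n} = n"
    using up_to_iff_Ico[of "{0..<n}" n] up_to[of "{0..<n}"] by (cases n) auto
  have u: "(\<lambda>_. undefined) \<in> space (PiM {0..<0::nat} (\<lambda>_. count_space UNIV :: 's measure))"
    by (simp add: space_PiM)
  have sC: "sets (C 0 n (\<lambda>_. undefined)) = sets (PiM {0..<n} (\<lambda>_. count_space UNIV))"
    using sets_C[OF u, of n] by simp
  have spC: "space (C 0 n (\<lambda>_. undefined)) = extensional {0..<n}"
    using sets_eq_imp_space_eq[OF sC] by (simp add: space_PiM PiE_def)
  have "(\<integral>\<omega>. f (restrict \<omega> {0..<n}) \<partial>path_measure K s) =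
      (\<integral>x. f x \<partial>distr PF.lim (PiM {0..<n} (\<lambda>_. count_space UNIV)) (\<lambda>x. restrict x {0..<n}))"
    unfolding path_measure_def using f
    by (subst integral_distr) (auto simp: measurable_cong_sets[OF PF.sets_lim refl] intro!: measurable_restrict_subset)
  also have "\<dots> = (\<integral>x. f x \<partial>CI {0..<n})"
    by (subst distr_lim) auto
  also have "\<dots> = (\<integral>x. f (restrict x {0..<n}) \<partial>C 0 n (\<lambda>_. undefined))"
    unfolding CI_def up using f
    by (subst integral_distr) (auto simp: measurable_cong_sets[OF sC refl] intro!: measurable_restrict_subset)
  also have "\<dots> = (\<integral>x. f x \<partial>C 0 n (\<lambda>_. undefined))"
    by (intro Bochner_Integration.integral_cong) (auto simp: spC extensional_restrict)
  finally show ?thesis .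
qed

text \<open>The projection to no coordinates is a marginal, hence has mass 1, and an image measure
  keeps the total mass.\<close>

lemma prob_space_path_measure: "prob_space (path_measure K s)"
proof -
  interpret Ionescu_Tulcea "path_step K s" "\<lambda>_. count_space UNIV"
    by (rule Ionescu_Tulcea_path_step)
  have "prob_space (distr PF.lim (PiM {} (\<lambda>_. count_space UNIV)) (\<lambda>x. restrict x {}))"
    by (subst distr_lim) (auto intro: PF.prob_space_P)
  then show ?thesis
    unfolding path_measure_def
    by (rule prob_space_distrD[rotated])
       (auto simp: measurable_cong_sets[OF PF.sets_lim refl] intro!: measurable_restrict_subset)
qed

text \<open>Markov property: \<open>C 0 (Suc n)\<close> is \<open>C 0 n\<close> followed by one draw
  from \<open>path_step K s n\<close>, so the last coordinate can be integrated out first. The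
  bounds \<open>c\<close> and \<open>d\<close> secure integrability throughout.\<close>

lemma integral_path_measure_Suc:
  fixes G :: "(nat \<Rightarrow> 's) \<Rightarrow> real" and h :: "'s \<Rightarrow> real"
  assumes G[measurable]: "G \<in> borel_measurable (PiM {0..<n} (\<lambda>_. count_space UNIV))"
    and G_bd: "\<And>x. \<bar>G x\<bar> \<le> c" and h_bd: "\<And>x. \<bar>h x\<bar> \<le> d"
  shows "(\<integral>\<omega>. G (restrict \<omega> {0..<n}) * h (\<omega> n) \<partial>path_measure K s) =
    (\<integral>\<omega>. G (restrict \<omega> {0..<n}) * (\<integral>y. h y \<partial>path_step K s n \<omega>) \<partial>path_measure K s)"
proof -
  interpret Ionescu_Tulcea "path_step K s" "\<lambda>_. count_space UNIV"
    by (rule Ionescu_Tulcea_path_step)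
  let ?PM = "\<lambda>n. PiM {0..<n} (\<lambda>_. count_space UNIV :: 's measure)"
  let ?u = "\<lambda>_::nat. undefined :: 's"
  have u: "?u \<in> space (PiM {0..<0} (\<lambda>_. count_space UNIV))"
    by (simp add: space_PiM)
  have sC: "sets (C 0 n ?u) = sets (?PM n)"
    using sets_C[OF u, of n] by simp
  interpret pC: prob_space "C 0 n ?u"
    by (rule prob_space_C[OF u])
  have [measurable]: "(\<lambda>\<omega>. \<omega> n) \<in> ?PM (Suc n) \<rightarrow>\<^sub>M count_space UNIV"
    by (intro measurable_component_singleton) auto
  have [measurable]: "(\<lambda>\<omega>. restrict \<omega> {0..<n}) \<in> ?PM (Suc n) \<rightarrow>\<^sub>M ?PM n"
    by (intro measurable_restrict_subset) auto
  have [measurable]: "h \<in> borel_measurable (count_space UNIV)"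
    by simp
  define F where "F x = G (restrict x {0..<n}) * h (x n)" for x
  have F[measurable]: "F \<in> borel_measurable (?PM (Suc n))"
    unfolding F_def by measurable
  have c: "0 \<le> c" using G_bd[of undefined] by linarith
  have F_bd: "norm (F x) \<le> c * d" for x
    unfolding F_def by (simp add: abs_mult mult_mono G_bd h_bd c)
  \<comment> \<open>\<open>path_step K s n\<close> reads at most the coordinate
    \<open>n - 1\<close>, which the restriction keeps.\<close>
  have inner: "(\<integral>y. h y \<partial>path_step K s n \<omega>) = (\<integral>y. h y \<partial>path_step K s n (restrict \<omega> {0..<n}))" for \<omega>
    by (cases n) (auto simp: path_step_def)
  have "(\<integral>\<omega>. G (restrict \<omega> {0..<n}) * h (\<omega> n) \<partial>path_measure K s) =
      (\<integral>\<omega>. F (restrict \<omega> {0..<Suc n}) \<partial>path_measure K s)"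
    by (intro Bochner_Integration.integral_cong) (auto simp: F_def restrict_restrict Int_absorb1)
  also have "\<dots> = (\<integral>x. F x \<partial>C 0 (Suc n) ?u)"
    by (rule integral_path_measure_restrict[OF F])
  also have "\<dots> = (\<integral>x. \<integral>y. F y \<partial>eP n x \<partial>C 0 n ?u)"
    unfolding C.simps add_0
  proof (rule integral_bind[where K="?PM (Suc n)" and B="c * d" and B'=1])
    show "eP n \<in> C 0 n ?u \<rightarrow>\<^sub>M subprob_algebra (?PM (Suc n))"
      using measurable_eP[of n] by (simp add: measurable_cong_sets[OF sC refl])
    show "AE x in C 0 n ?u. emeasure (eP n x) (space (eP n x)) \<le> ennreal 1"
    proof (rule AE_I2)
      fix x assume "x \<in> space (C 0 n ?u)"
      then have "x \<in> space (?PM n)" using sets_eq_imp_space_eq[OF sC] by simp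
      then interpret prob_space "eP n x" by (rule prob_space_eP)
      show "emeasure (eP n x) (space (eP n x)) \<le> ennreal 1"
        using emeasure_space_1 by simp
    qed
  qed (use F_bd pC.finite_measure_axioms in auto)
  also have "\<dots> = (\<integral>x. G x * (\<integral>y. h y \<partial>path_step K s n x) \<partial>C 0 n ?u)"
  proof (intro Bochner_Integration.integral_cong refl)
    fix x assume "x \<in> space (C 0 n ?u)"
    then have x: "x \<in> space (?PM n)" using sets_eq_imp_space_eq[OF sC] by simp
    then have ext: "x \<in> extensional {0..<n}" by (simp add: space_PiM PiE_def)
    have sP: "sets (path_step K s n x) = sets (count_space UNIV)"
      by (simp add: path_step_def)
    have "(\<integral>y. F y \<partial>eP n x) = (\<integral>y. F (x(n := y)) \<partial>path_step K s n x)"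
      unfolding eP_def using x
      by (subst integral_distr)
         (auto intro!: measurable_fun_upd[where J="{0..<n}"]
           simp: measurable_cong_sets[OF sP refl] space_PiM PiE_iff extensional_def)
    also have "\<dots> = (\<integral>y. G x * h y \<partial>path_step K s n x)"
    proof (intro Bochner_Integration.integral_cong refl)
      fix y
      have "restrict (x(n := y)) {0..<n} = x"
        using ext by (auto simp: fun_eq_iff restrict_def extensional_def)
      then show "F (x(n := y)) = G x * h y" by (simp add: F_def)
    qed
    also have "\<dots> = G x * (\<integral>y. h y \<partial>path_step K s n x)" by simp
    finally show "(\<integral>y. F y \<partial>eP n x) = G x * (\<integral>y. h y \<partial>path_step K s n x)" .
  qed
  also have "\<dots> = (\<integral>\<omega>. G (restrict \<omega> {0..<n}) * (\<integral>y. h y \<partial>path_step K s n (restrict \<omega> {0..<n})) \<partial>path_measure K s)"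
  proof (rule integral_path_measure_restrict[symmetric])
    have "(\<lambda>x. \<integral>y. h y \<partial>path_step K s n x) \<in> borel_measurable (?PM n)"
      by (rule integral_measurable_subprob_algebra[THEN measurable_compose[OF P]]) simp
    then show "(\<lambda>x. G x * (\<integral>y. h y \<partial>path_step K s n x)) \<in> borel_measurable (?PM n)"
      by measurable
  qed
  finally show ?thesis unfolding inner[symmetric] .
qed


section \<open>Measurability and integrals over paths that have avoided a set\<close>

lemma measurable_path_component [measurable]:
  "(\<lambda>\<omega>. \<omega> n) \<in> path_measure K s \<rightarrow>\<^sub>M count_space UNIV"
  by (simp add: measurable_cong_sets[OF sets_path_measure refl] measurable_component_singleton)

lemma borel_measurable_path_component [measurable]:
  "(\<lambda>\<omega>. f (\<omega> n)) \<in> borel_measurable (path_measure K s)"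
  by (rule measurable_compose[OF measurable_path_component]) simp

lemma abs_expectation_pmf_le:
  fixes h :: "'s \<Rightarrow> real"
  assumes "\<And>x. \<bar>h x\<bar> \<le> d"
  shows "\<bar>measure_pmf.expectation p h\<bar> \<le> d"
proof -
  have "integrable p h"
    by (rule measure_pmf.integrable_const_bound[of _ d]) (use assms in auto)
  then show ?thesis
    using assms measure_pmf.integral_le_const[of p h d] measure_pmf.integral_ge_const[of p h "- d"]
    by (simp add: abs_le_iff minus_le_iff)
qed

text \<open>The indicator that the hitting time of \<open>A\<close> is at least \<open>n\<close>. In
  product form it is measurable factor by factor, and one more time step contributes one more
  factor.\<close>

definition alive :: "'s set \<Rightarrow> nat \<Rightarrow> (nat \<Rightarrow> 's) \<Rightarrow> real" where
  "alive A n \<omega> = (\<Prod>i<n. indicator (- A) (\<omega> i))"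

lemma alive_0 [simp]: "alive A 0 \<omega> = 1"
  by (simp add: alive_def)

lemma alive_Suc: "alive A (Suc n) \<omega> = alive A n \<omega> * indicator (- A) (\<omega> n)"
  by (simp add: alive_def)

lemma alive_eq: "alive A n \<omega> = of_bool (\<forall>i<n. \<omega> i \<notin> A)"
  by (induction n) (auto simp: alive_Suc less_Suc_eq indicator_def)

lemma alive_nonneg: "0 \<le> alive A n \<omega>"
  by (simp add: alive_eq)

lemma borel_measurable_alive [measurable]: "alive A n \<in> borel_measurable (path_measure K s)"
  unfolding alive_def[abs_def] by measurable

lemma integrable_path_bounded:
  fixes f :: "(nat \<Rightarrow> 's) \<Rightarrow> real"
  assumes "f \<in> borel_measurable (path_measure K s)" "\<And>\<omega>. \<bar>f \<omega>\<bar> \<le> c"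
  shows "integrable (path_measure K s) f"
proof -
  interpret prob_space "path_measure K s" by (rule prob_space_path_measure)
  show ?thesis by (rule integrable_const_bound[of _ c]) (use assms in auto)
qed

lemma abs_alive_mult_le: "\<bar>x\<bar> \<le> d \<Longrightarrow> \<bar>alive A n \<omega> * x\<bar> \<le> d"
  by (auto simp: alive_eq)

lemma integrable_alive_mult:
  assumes "\<And>x. \<bar>h x\<bar> \<le> d"
  shows "integrable (path_measure K s) (\<lambda>\<omega>. alive A m \<omega> * h (\<omega> n))"
  by (rule integrable_path_bounded[of _ _ _ d]) (use assms in \<open>auto intro: abs_alive_mult_le\<close>)

text \<open>\<open>alive A (Suc n)\<close> reads only the coordinates up to \<open>n\<close>, so it
  can serve as the history factor in the Markov property.\<close>

lemma integral_alive_Suc: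
  fixes h :: "'s \<Rightarrow> real"
  assumes "\<And>x. \<bar>h x\<bar> \<le> d"
  shows "(\<integral>\<omega>. alive A (Suc n) \<omega> * h (\<omega> (Suc n)) \<partial>path_measure K s) =
    (\<integral>\<omega>. alive A (Suc n) \<omega> * measure_pmf.expectation (K (\<omega> n)) h \<partial>path_measure K s)"
proof -
  have m: "alive A (Suc n) \<in> borel_measurable (PiM {0..<Suc n} (\<lambda>_. count_space UNIV))"
    unfolding alive_def[abs_def]
  proof (intro borel_measurable_prod)
    fix i assume "i \<in> {..<Suc n}"
    then have "(\<lambda>\<omega>. \<omega> i) \<in> PiM {0..<Suc n} (\<lambda>_. count_space UNIV :: 's measure) \<rightarrow>\<^sub>M count_space UNIV"
      by (intro measurable_component_singleton) auto
    then show "(\<lambda>\<omega>. indicator (- A) (\<omega> i) :: real) \<in>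
        borel_measurable (PiM {0..<Suc n} (\<lambda>_. count_space UNIV))"
      by (rule measurable_compose) simp
  qed
  have "alive A (Suc n) (restrict \<omega> {0..<Suc n}) = alive A (Suc n) \<omega>" for \<omega>
    by (simp add: alive_def)
  then show ?thesis
    using integral_path_measure_Suc[OF m, where c=1 and h=h and d=d and K=K and s=s] assms
      abs_alive_mult_le[of 1 1 A "Suc n"]
    by (simp add: path_step_def)
qed

section \<open>The first step of the chain\<close>

lemma integral_path_measure_0:
  fixes h :: "'s \<Rightarrow> real"
  assumes "\<And>x. \<bar>h x\<bar> \<le> d"
  shows "(\<integral>\<omega>. h (\<omega> 0) \<partial>path_measure K s) = h s"
proof -
  interpret prob_space "path_measure K s" by (rule prob_space_path_measure)
  show ?thesis
    using integral_path_measure_Suc[of "\<lambda>_. 1" 0 1 h d K s] assms prob_space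
    by (simp add: path_step_def)
qed

text \<open>One Markov step from time 0, with \<open>A = {}\<close> so that the factor
  \<open>alive\<close> is constantly 1.\<close>

lemma integral_path_measure_1:
  fixes h :: "'s \<Rightarrow> real"
  assumes h: "\<And>x. \<bar>h x\<bar> \<le> d"
  shows "(\<integral>\<omega>. h (\<omega> 1) \<partial>path_measure K s) = measure_pmf.expectation (K s) h"
  using integral_alive_Suc[where h=h and d=d and A="{}" and n=0 and K=K and s=s, OF h]
    integral_path_measure_0[where h="\<lambda>x. measure_pmf.expectation (K x) h" and d=d and K=K and s=s]
  by (simp add: alive_eq abs_expectation_pmf_le[OF h])

text \<open>Indicators are bounded test functions, so they determine the law of
  \<open>\<omega> 1\<close>. Knowing this law gives access to unbounded functions such as the
  exponential terms.\<close>

lemma distr_path_measure_1: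
  "distr (path_measure K s) (count_space UNIV) (\<lambda>\<omega>. \<omega> 1) = measure_pmf (K s)"
proof (rule measure_eqI)
  fix X assume "X \<in> sets (distr (path_measure K s) (count_space UNIV) (\<lambda>\<omega>. \<omega> 1))"
  interpret D: prob_space "distr (path_measure K s) (count_space UNIV) (\<lambda>\<omega>. \<omega> 1)"
    by (intro prob_space.prob_space_distr prob_space_path_measure) simp
  have "measure (distr (path_measure K s) (count_space UNIV) (\<lambda>\<omega>. \<omega> 1)) X =
      (\<integral>x. indicator X x \<partial>distr (path_measure K s) (count_space UNIV) (\<lambda>\<omega>. \<omega> 1))"
    by simp
  also have "\<dots> = (\<integral>\<omega>. indicator X (\<omega> 1) \<partial>path_measure K s)"
    by (rule integral_distr) auto
  also have "\<dots> = measure_pmf.expectation (K s) (indicator X)"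
    by (rule integral_path_measure_1[of _ 1]) (simp add: indicator_def)
  also have "\<dots> = measure (K s) X" by simp
  finally show "emeasure (distr (path_measure K s) (count_space UNIV) (\<lambda>\<omega>. \<omega> 1)) X = emeasure (K s) X"
    by (simp only: D.emeasure_eq_measure measure_pmf.emeasure_eq_measure)
qed simp

text \<open>With finitely many successors every function is integrable after one step, so only the
  one-step mean remains to be checked.\<close>

lemma harmonicI:
  assumes "\<And>s. finite (set_pmf (K s))"
    and "\<And>s. measure_pmf.expectation (K s) h = h s"
  shows "harmonic K h"
  unfolding harmonic_def
proof (intro allI conjI)
  fix s
  have "integrable (distr (path_measure K s) (count_space UNIV) (\<lambda>\<omega>. \<omega> 1)) h"
    unfolding distr_path_measure_1 using assms(1) by (rule integrable_measure_pmf_finite)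
  then show "integrable (path_measure K s) (\<lambda>\<omega>. h (\<omega> 1))"
    by (subst (asm) integrable_distr_eq) auto
  have "(\<integral>\<omega>. h (\<omega> 1) \<partial>path_measure K s) =
      (\<integral>x. h x \<partial>distr (path_measure K s) (count_space UNIV) (\<lambda>\<omega>. \<omega> 1))"
    by (subst integral_distr) auto
  then show "(\<integral>\<omega>. h (\<omega> 1) \<partial>path_measure K s) = h s"
    by (simp only: distr_path_measure_1 assms(2))
qed

section \<open>Hitting a set\<close>

text \<open>The probability of visiting \<open>A\<close> within \<open>n\<close> steps, time 0
  included. The first-step recursion lets lower bounds be proved by induction, without path
  measures.\<close>

primrec hit_prob :: "('s \<Rightarrow> 's pmf) \<Rightarrow> 's set \<Rightarrow> nat \<Rightarrow> 's \<Rightarrow> real" where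
  "hit_prob K A 0 s = indicator A s"
| "hit_prob K A (Suc n) s = (if s \<in> A then 1 else measure_pmf.expectation (K s) (hit_prob K A n))"

lemma hit_prob_bounds: "0 \<le> hit_prob K A n s \<and> hit_prob K A n s \<le> 1"
proof (induction n arbitrary: s)
  case (Suc n)
  then have "\<bar>measure_pmf.expectation (K s) (hit_prob K A n)\<bar> \<le> 1"
    by (intro abs_expectation_pmf_le) (simp add: abs_le_iff order_trans[OF _ zero_le_one])
  moreover have "0 \<le> measure_pmf.expectation (K s) (hit_prob K A n)"
    using Suc by (intro Bochner_Integration.integral_nonneg) auto
  ultimately show ?case by simp
qed (simp add: indicator_def)

lemma abs_hit_prob_le: "\<bar>hit_prob K A n s\<bar> \<le> 1"
  using hit_prob_bounds[of K A n s] by simp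

lemma integrable_hit_prob: "integrable (measure_pmf p) (hit_prob K A n)"
  by (rule measure_pmf.integrable_const_bound[of _ 1]) (simp_all add: abs_hit_prob_le)

lemma integrable_alive_hit_prob:
  "integrable (path_measure K s) (\<lambda>\<omega>. alive A m \<omega> * hit_prob K A N (\<omega> n))"
  by (rule integrable_alive_mult[of _ 1]) (rule abs_hit_prob_le)

lemma hit_prob_in [simp]: "s \<in> A \<Longrightarrow> hit_prob K A n s = 1"
  by (cases n) auto

lemma hit_prob_le_Suc: "hit_prob K A n s \<le> hit_prob K A (Suc n) s"
proof (induction n arbitrary: s)
  case 0
  then show ?case using hit_prob_bounds[of K A 1 s] by (simp add: indicator_def)
next
  case (Suc n)
  then have "measure_pmf.expectation (K s) (hit_prob K A n) \<le>
      measure_pmf.expectation (K s) (hit_prob K A (Suc n))"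
    by (intro integral_mono integrable_hit_prob)
  then show ?case by simp
qed

lemma hit_prob_mono: "m \<le> n \<Longrightarrow> hit_prob K A m s \<le> hit_prob K A n s"
  by (rule lift_Suc_mono_le[of "\<lambda>n. hit_prob K A n s", OF hit_prob_le_Suc])

text \<open>\<open>alive A (Suc n)\<close> says that the hitting time of \<open>A\<close> exceeds \<open>n\<close>, so the difference of the two
  terms on the left is the probability that it lies in \<open>{n<..n + N}\<close>.\<close>

lemma integral_alive_diff:
  "(\<integral>\<omega>. alive A (Suc n) \<omega> \<partial>path_measure K s) - (\<integral>\<omega>. alive A (Suc (n + N)) \<omega> \<partial>path_measure K s) =
   (\<integral>\<omega>. alive A (Suc n) \<omega> * hit_prob K A N (\<omega> n) \<partial>path_measure K s)"
proof -
  have int1: "integrable (path_measure K s) (alive A m)" for m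
    using integrable_alive_mult[of "\<lambda>_. 1" 1 K s A m] by simp
  have "(\<integral>\<omega>. alive A (Suc (n + N)) \<omega> \<partial>path_measure K s) =
      (\<integral>\<omega>. alive A (Suc n) \<omega> * (1 - hit_prob K A N (\<omega> n)) \<partial>path_measure K s)"
  proof (induction N arbitrary: n)
    case 0
    show ?case by (auto intro!: Bochner_Integration.integral_cong simp: alive_Suc indicator_def)
  next
    case (Suc N)
    have b: "\<bar>1 - hit_prob K A N x\<bar> \<le> 1" for x
      using hit_prob_bounds[of K A N x] by simp
    have "(\<integral>\<omega>. alive A (Suc (n + Suc N)) \<omega> \<partial>path_measure K s) =
      (\<integral>\<omega>. alive A (Suc (Suc n)) \<omega> * (1 - hit_prob K A N (\<omega> (Suc n))) \<partial>path_measure K s)"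
      using Suc.IH[of "Suc n"] by simp
    also have "\<dots> = (\<integral>\<omega>. alive A (Suc n) \<omega> * (1 - hit_prob K A N (\<omega> (Suc n))) \<partial>path_measure K s)"
      by (intro Bochner_Integration.integral_cong refl) (auto simp: alive_Suc[of A "Suc n"] indicator_def)
    also have "\<dots> = (\<integral>\<omega>. alive A (Suc n) \<omega> *
        measure_pmf.expectation (K (\<omega> n)) (\<lambda>x. 1 - hit_prob K A N x) \<partial>path_measure K s)"
      by (rule integral_alive_Suc[OF b])
    also have "\<dots> = (\<integral>\<omega>. alive A (Suc n) \<omega> * (1 - hit_prob K A (Suc N) (\<omega> n)) \<partial>path_measure K s)"
      by (intro Bochner_Integration.integral_cong refl)
         (simp add: alive_Suc indicator_def integrable_hit_prob)
    finally show ?case .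
  qed
  also have "\<dots> = (\<integral>\<omega>. alive A (Suc n) \<omega> \<partial>path_measure K s) -
      (\<integral>\<omega>. alive A (Suc n) \<omega> * hit_prob K A N (\<omega> n) \<partial>path_measure K s)"
    by (simp add: right_diff_distrib integrable_alive_hit_prob int1)
  finally show ?thesis by simp
qed

text \<open>Only steps from \<open>R - A\<close> are known to stay in \<open>R\<close>, so a path is
  kept in \<open>R\<close> up to and including its first visit to \<open>A\<close>. For the walk,
  \<open>R\<close> is \<open>B\<close>, which can be left only from the diagonal.\<close>

lemma AE_alive_in_closed:
  assumes closed: "\<And>x. x \<in> R - A \<Longrightarrow> set_pmf (K x) \<subseteq> R" and s: "s \<in> R"
  shows "AE \<omega> in path_measure K s. alive A n \<omega> \<noteq> 0 \<longrightarrow> \<omega> n \<in> R"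
proof (induction n)
  case 0
  have "(\<integral>\<omega>. indicator (- R) (\<omega> 0) \<partial>path_measure K s) = (0 :: real)"
    using s by (subst integral_path_measure_0[of _ 1]) (simp_all add: indicator_def)
  then have "AE \<omega> in path_measure K s. indicator (- R) (\<omega> 0) = (0 :: real)"
    by (subst (asm) integral_nonneg_eq_0_iff_AE)
       (auto intro!: integrable_path_bounded[of _ _ _ 1] simp: indicator_def)
  then show ?case by eventually_elim (auto simp: indicator_def split: if_splits)
next
  case (Suc n)
  let ?i = "indicator (- R) :: 'a \<Rightarrow> real"
  have b: "\<bar>?i x\<bar> \<le> 1" for x by (simp add: indicator_def)
  have "AE \<omega> in path_measure K s. alive A (Suc n) \<omega> * measure_pmf.expectation (K (\<omega> n)) ?i = 0"
    using Suc.IH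
  proof eventually_elim
    fix \<omega> assume IH: "alive A n \<omega> \<noteq> 0 \<longrightarrow> \<omega> n \<in> R"
    show "alive A (Suc n) \<omega> * measure_pmf.expectation (K (\<omega> n)) ?i = 0"
    proof (cases "alive A (Suc n) \<omega> = 0")
      case False
      then have "\<omega> n \<in> R - A"
        using IH by (auto simp: alive_Suc indicator_def split: if_splits)
      then have "measure (K (\<omega> n)) (- R) = 0"
        using closed by (auto simp: measure_pmf_zero_iff)
      then show ?thesis by simp
    qed simp
  qed
  \<comment> \<open>Leaving \<open>R\<close> while surviving has integral 0 by the Markov property;
    being nonnegative, it vanishes almost surely.\<close>
  then have "(\<integral>\<omega>. alive A (Suc n) \<omega> * ?i (\<omega> (Suc n)) \<partial>path_measure K s) = 0"
    by (subst integral_alive_Suc[OF b]) (rule integral_eq_zero_AE)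
  then have "AE \<omega> in path_measure K s. alive A (Suc n) \<omega> * ?i (\<omega> (Suc n)) = 0"
    by (subst (asm) integral_nonneg_eq_0_iff_AE)
       (auto intro!: integrable_alive_mult[OF b] simp: alive_nonneg)
  then show ?case by eventually_elim (auto simp: indicator_def split: if_splits)
qed

text \<open>Survival forever may have positive probability, so smallness must come from
  \<open>h\<close>. Survivors with small \<open>\<bar>h\<bar>\<close> contribute little; those with
  large \<open>\<bar>h\<bar>\<close> soon hit \<open>A\<close> with probability at least \<delta>,
  and at late times little mass is left that still hits.\<close>

lemma tendsto_integral_alive:
  fixes h :: "'s \<Rightarrow> real"
  assumes bound: "\<And>x. \<bar>h x\<bar> \<le> C"
    and closed: "\<And>x. x \<in> R - A \<Longrightarrow> set_pmf (K x) \<subseteq> R" and s: "s \<in> R"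
    and hit: "\<And>e. 0 < e \<Longrightarrow>
      \<exists>N \<delta>. 0 < \<delta> \<and> (\<forall>x\<in>R - A. e \<le> \<bar>h x\<bar> \<longrightarrow> \<delta> \<le> hit_prob K A N x)"
  shows "(\<lambda>n. \<integral>\<omega>. alive A (Suc n) \<omega> * h (\<omega> n) \<partial>path_measure K s) \<longlonglongrightarrow> 0"
proof (rule LIMSEQ_I)
  fix r :: real assume r: "0 < r"
  interpret prob_space "path_measure K s" by (rule prob_space_path_measure)
  have in_R: "AE \<omega> in path_measure K s. alive A n \<omega> \<noteq> 0 \<longrightarrow> \<omega> n \<in> R" for n
    by (rule AE_alive_in_closed) (fact closed s)+
  obtain N \<delta> where \<delta>: "0 < \<delta>"
    and N: "\<And>x. x \<in> R - A \<Longrightarrow> r / 2 \<le> \<bar>h x\<bar> \<Longrightarrow> \<delta> \<le> hit_prob K A N x"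
    using hit[of "r / 2"] r by auto
  have C: "0 \<le> C" using bound[of undefined] by linarith
  have int1: "integrable (path_measure K s) (alive A m)" for m
    using integrable_alive_mult[of "\<lambda>_. 1" 1 K s A m] by simp
  define a where "a n = (\<integral>\<omega>. alive A (Suc n) \<omega> \<partial>path_measure K s)" for n
  have "a (Suc n) \<le> a n" for n
    unfolding a_def using int1
    by (intro integral_mono) (auto simp: alive_eq)
  moreover have "0 \<le> a n" for n
    unfolding a_def by (intro Bochner_Integration.integral_nonneg) (simp add: alive_nonneg)
  ultimately have "convergent a"
    by (intro Bseq_monoseq_convergent decseq_imp_monoseq decseq_SucI decseq_bounded) auto
  then obtain L where L: "a \<longlonglongrightarrow> L" by (auto simp: convergent_def)
  \<comment> \<open>This difference is the probability of a first hit in a window of length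
    \<open>N\<close> after time \<open>n\<close>; it tends to 0 since the survival probabilities
    converge.\<close>
  then have "(\<lambda>n. a n - a (n + N)) \<longlonglongrightarrow> L - L"
    by (intro tendsto_diff LIMSEQ_ignore_initial_segment)
  then have "(\<lambda>n. C / \<delta> * (a n - a (n + N))) \<longlonglongrightarrow> C / \<delta> * (L - L)"
    by (rule tendsto_mult_left)
  then have "eventually (\<lambda>n. C / \<delta> * (a n - a (n + N)) < r / 2) sequentially"
    using r by (intro order_tendstoD(2)) auto
  then obtain n0 where n0: "\<And>n. n0 \<le> n \<Longrightarrow> C / \<delta> * (a n - a (n + N)) < r / 2"
    by (auto simp: eventually_sequentially)
  show "\<exists>n0. \<forall>n\<ge>n0. norm ((\<integral>\<omega>. alive A (Suc n) \<omega> * h (\<omega> n) \<partial>path_measure K s) - 0) < r"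
  proof (intro exI allI impI)
    fix n assume "n0 \<le> n"
    have "norm (\<integral>\<omega>. alive A (Suc n) \<omega> * h (\<omega> n) \<partial>path_measure K s) \<le>
        (\<integral>\<omega>. norm (alive A (Suc n) \<omega> * h (\<omega> n)) \<partial>path_measure K s)"
      by (rule integral_norm_bound)
    \<comment> \<open>Pointwise on survivors: if \<open>\<bar>h\<bar> < r / 2\<close> the first
      summand suffices; otherwise \<open>hit_prob\<close> is at least \<delta>, and the second
      summand is at least \<open>C\<close>.\<close>
    also have "\<dots> \<le> (\<integral>\<omega>. r / 2 + C / \<delta> * (alive A (Suc n) \<omega> * hit_prob K A N (\<omega> n)) \<partial>path_measure K s)"
    proof (rule integral_mono_AE)
      show "integrable (path_measure K s) (\<lambda>\<omega>. norm (alive A (Suc n) \<omega> * h (\<omega> n)))"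
        by (intro integrable_norm integrable_alive_mult[OF bound])
      show "integrable (path_measure K s)
          (\<lambda>\<omega>. r / 2 + C / \<delta> * (alive A (Suc n) \<omega> * hit_prob K A N (\<omega> n)))"
        by (intro Bochner_Integration.integrable_add integrable_mult_right
            integrable_alive_hit_prob) simp
      show "AE \<omega> in path_measure K s. norm (alive A (Suc n) \<omega> * h (\<omega> n)) \<le>
          r / 2 + C / \<delta> * (alive A (Suc n) \<omega> * hit_prob K A N (\<omega> n))"
        using in_R[of n]
      proof eventually_elim
        fix \<omega> assume IH: "alive A n \<omega> \<noteq> 0 \<longrightarrow> \<omega> n \<in> R"
        have nn: "0 \<le> C / \<delta> * hit_prob K A N (\<omega> n)"
          using C \<delta> hit_prob_bounds[of K A N "\<omega> n"] by simp
        show "norm (alive A (Suc n) \<omega> * h (\<omega> n)) \<le>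
          r / 2 + C / \<delta> * (alive A (Suc n) \<omega> * hit_prob K A N (\<omega> n))"
        proof (cases "alive A (Suc n) \<omega> = 0")
          case True
          then show ?thesis using r by simp
        next
          case False
          then have 1: "alive A (Suc n) \<omega> = 1" by (simp add: alive_eq split: if_splits)
          have R: "\<omega> n \<in> R - A"
            using IH False by (auto simp: alive_Suc indicator_def split: if_splits)
          show ?thesis
          proof (cases "r / 2 \<le> \<bar>h (\<omega> n)\<bar>")
            case True
            have "C \<le> C / \<delta> * hit_prob K A N (\<omega> n)"
              using N[OF R True] C \<delta> mult_left_mono[of \<delta> "hit_prob K A N (\<omega> n)" "C / \<delta>"] by simp
            then show ?thesis using 1 r bound[of "\<omega> n"] by simp
          next
            case False
            then show ?thesis using 1 nn by simp
          qed
        qed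
      qed
    qed
    also have "\<dots> = r / 2 + C / \<delta> * (a n - a (n + N))"
      unfolding a_def integral_alive_diff
      by (subst Bochner_Integration.integral_add)
         (auto intro!: integrable_alive_hit_prob simp: prob_space[simplified])
    also have "\<dots> < r"
      using n0[OF \<open>n0 \<le> n\<close>] by linarith
    finally show "norm ((\<integral>\<omega>. alive A (Suc n) \<omega> * h (\<omega> n) \<partial>path_measure K s) - 0) < r"
      by simp
  qed
qed

text \<open>Optional stopping: the payoff of hits before time \<open>n\<close> plus the value of
  \<open>h\<close> on the paths still alive has constant expectation \<open>h s\<close>. The second
  part vanishes in the limit and the first converges boundedly to \<open>g\<close>.\<close>

lemma expectation_at_hitting_time:
  fixes h :: "'s \<Rightarrow> real"
  assumes bound: "\<And>x. \<bar>h x\<bar> \<le> C"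
    and closed: "\<And>x. x \<in> R - A \<Longrightarrow> set_pmf (K x) \<subseteq> R" and s: "s \<in> R"
    and mean: "\<And>x. x \<in> R - A \<Longrightarrow> measure_pmf.expectation (K x) h = h x"
    and hit: "\<And>e. 0 < e \<Longrightarrow>
      \<exists>N \<delta>. 0 < \<delta> \<and> (\<forall>x\<in>R - A. e \<le> \<bar>h x\<bar> \<longrightarrow> \<delta> \<le> hit_prob K A N x)"
  defines "T \<equiv> \<lambda>\<omega>. Inf (enat ` {k. \<omega> k \<in> A})"
  defines "g \<equiv> \<lambda>\<omega>. h (\<omega> (the_enat (T \<omega>))) * indicator {\<omega>. T \<omega> < \<infinity>} \<omega>"
  shows "integrable (path_measure K s) g" and "h s = (\<integral>\<omega>. g \<omega> \<partial>path_measure K s)"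
proof -
  interpret prob_space "path_measure K s" by (rule prob_space_path_measure)
  have in_R: "AE \<omega> in path_measure K s. alive A n \<omega> \<noteq> 0 \<longrightarrow> \<omega> n \<in> R" for n
    by (rule AE_alive_in_closed) (fact closed s)+
  have C: "0 \<le> C" using bound[of undefined] by linarith
  \<comment> \<open>After the first visit \<open>alive\<close> is 0, so at most one summand is
    nonzero: \<open>G n\<close> is \<open>h\<close> at the hitting time if that is below
    \<open>n\<close>, and 0 otherwise.\<close>
  define G where "G n \<omega> = (\<Sum>k<n. alive A k \<omega> * indicator A (\<omega> k) * h (\<omega> k))" for n \<omega>
  have [measurable]: "G n \<in> borel_measurable (path_measure K s)" for n
    unfolding G_def[abs_def] by measurable
  \<comment> \<open>For a path avoiding \<open>A\<close> the infimum is over the empty set; the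
    indicator in \<open>g\<close> then discards the arbitrary value of \<open>the_enat\<close> at
    \<infinity>.\<close>
  have T_inf: "T \<omega> = \<infinity>" if "\<And>k. \<omega> k \<notin> A" for \<omega>
    using that by (simp add: T_def top_enat_def)
  have T_eq: "T \<omega> = enat k" if "\<omega> k \<in> A" "\<And>i. i < k \<Longrightarrow> \<omega> i \<notin> A" for \<omega> k
    unfolding T_def using that
    by (intro antisym Inf_lower Inf_greatest) (auto simp: not_less[symmetric])
  have G_T: "G n \<omega> = (if k < n then h (\<omega> k) else 0)"
    if k: "\<omega> k \<in> A" "\<And>i. i < k \<Longrightarrow> \<omega> i \<notin> A" for n k \<omega>
  proof -
    have "G n \<omega> = (\<Sum>i<n. if i = k then h (\<omega> k) else 0)"
      unfolding G_def
    proof (rule sum.cong)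
      fix i
      show "alive A i \<omega> * indicator A (\<omega> i) * h (\<omega> i) = (if i = k then h (\<omega> k) else 0)"
        using k by (cases i k rule: linorder_cases) (auto simp: alive_eq)
    qed simp
    then show ?thesis by simp
  qed
  have cases: "(\<forall>k. \<omega> k \<notin> A) \<or> (\<exists>k. \<omega> k \<in> A \<and> (\<forall>i<k. \<omega> i \<notin> A))" for \<omega> :: "nat \<Rightarrow> 's"
    using exists_least_iff[of "\<lambda>k. \<omega> k \<in> A"] by auto
  have lim: "(\<lambda>n. G n \<omega>) \<longlonglongrightarrow> g \<omega>" for \<omega>
    using cases[of \<omega>]
  proof (elim disjE exE conjE)
    assume "\<forall>k. \<omega> k \<notin> A"
    then show ?thesis using T_inf[of \<omega>] by (simp add: G_def g_def)
  next
    fix k assume k: "\<omega> k \<in> A" "\<forall>i<k. \<omega> i \<notin> A"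
    have "eventually (\<lambda>n. G n \<omega> = g \<omega>) sequentially"
      using eventually_gt_at_top[of k]
      by eventually_elim (use k in \<open>simp add: G_T[of \<omega> k] g_def T_eq[of \<omega> k]\<close>)
    then show ?thesis by (rule tendsto_eventually)
  qed
  have G_bd: "\<bar>G n \<omega>\<bar> \<le> C" for n \<omega>
    using cases[of \<omega>]
  proof (elim disjE exE conjE)
    assume "\<forall>k. \<omega> k \<notin> A"
    then show ?thesis using C by (simp add: G_def)
  qed (use C bound in \<open>simp add: G_T\<close>)
  have dom: "integrable (path_measure K s) g" "(\<lambda>n. expectation (G n)) \<longlonglongrightarrow> expectation g"
    using lim G_bd borel_measurable_LIMSEQ_real[of "path_measure K s" G g]
    by (auto intro!: integrable_dominated_convergence[where w="\<lambda>_. C" and s=G]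
        integral_dominated_convergence[where w="\<lambda>_. C" and s=G])
  show "integrable (path_measure K s) g" by fact
  have "expectation (G (Suc n)) + expectation (\<lambda>\<omega>. alive A (Suc n) \<omega> * h (\<omega> n)) = h s" for n
  proof -
    \<comment> \<open>Paths whose first visit is at time \<open>n\<close> move from the second
      expectation to the first.\<close>
    have split: "expectation (G (Suc n)) + expectation (\<lambda>\<omega>. alive A (Suc n) \<omega> * h (\<omega> n)) =
        expectation (G n) + expectation (\<lambda>\<omega>. alive A n \<omega> * h (\<omega> n))" for n
    proof -
      have "G (Suc n) \<omega> + alive A (Suc n) \<omega> * h (\<omega> n) = G n \<omega> + alive A n \<omega> * h (\<omega> n)" for \<omega>
        by (simp add: G_def alive_Suc indicator_def)
      then show ?thesis
        by (subst (1 2) Bochner_Integration.integral_add[symmetric])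
           (auto intro!: integrable_alive_mult[OF bound] integrable_path_bounded[OF _ G_bd])
    qed
    have "expectation (G n) + expectation (\<lambda>\<omega>. alive A n \<omega> * h (\<omega> n)) = h s"
    proof (induction n)
      case 0
      show ?case using integral_path_measure_0[OF bound] by (simp add: G_def)
    next
      case (Suc n)
      have "expectation (\<lambda>\<omega>. alive A (Suc n) \<omega> * h (\<omega> (Suc n))) =
          expectation (\<lambda>\<omega>. alive A (Suc n) \<omega> * measure_pmf.expectation (K (\<omega> n)) h)"
        by (rule integral_alive_Suc[OF bound])
      also have "\<dots> = expectation (\<lambda>\<omega>. alive A (Suc n) \<omega> * h (\<omega> n))"
      proof (rule integral_cong_AE)
        show "AE \<omega> in path_measure K s.
            alive A (Suc n) \<omega> * measure_pmf.expectation (K (\<omega> n)) h = alive A (Suc n) \<omega> * h (\<omega> n)"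
          using in_R[of n]
        proof eventually_elim
          case (elim \<omega>)
          then show ?case using mean[of "\<omega> n"] by (auto simp: alive_Suc indicator_def)
        qed
      qed simp_all
      finally show ?case using split[of n] Suc.IH by simp
    qed
    then show ?thesis using split[of n] by simp
  qed
  moreover have "(\<lambda>n. expectation (\<lambda>\<omega>. alive A (Suc n) \<omega> * h (\<omega> n))) \<longlonglongrightarrow> 0"
    by (rule tendsto_integral_alive) (fact bound closed s hit)+
  ultimately have "(\<lambda>n. h s) \<longlonglongrightarrow> expectation g + 0"
    using tendsto_add[OF LIMSEQ_Suc[OF dom(2)]] by fastforce
  then show "h s = expectation g" by (simp add: LIMSEQ_const_iff)
qed

section \<open>The modulated walk\<close>

text \<open>The coefficients are indexed by \<open>A\<close>, although \<open>f\<close> may repeat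
  vectors: they are placed on a set \<open>B\<close> of representatives and are 0 elsewhere.\<close>

lemma (in module) in_span_imageE:
  assumes "finite A" and "x \<in> span (f ` A)"
  obtains u where "x = (\<Sum>a\<in>A. scale (u a) (f a))"
proof -
  obtain B where B: "B \<subseteq> A" "inj_on f B" "f ` A = f ` B"
    by (metis subset_image_inj subset_refl)
  have "finite (f ` B)"
    using assms(1) B(1) by (auto intro: finite_subset)
  then have "x \<in> range (\<lambda>v. \<Sum>y\<in>f ` B. scale (v y) y)"
    using assms(2) unfolding B(3) by (simp only: span_finite)
  then obtain v where "x = (\<Sum>y\<in>f ` B. scale (v y) y)"
    by blast
  also have "\<dots> = (\<Sum>b\<in>B. scale (v (f b)) (f b))"
    using B(2) by (simp add: sum.reindex)
  also have "\<dots> = (\<Sum>a\<in>A. scale (if a \<in> B then v (f a) else 0) (f a))"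
    using assms(1) B(1) by (intro sum.mono_neutral_cong_left) auto
  finally show ?thesis by (rule that)
qed

text \<open>All vectors are real, so a complex linear relation between them stays valid when each
  coefficient is replaced by its real part.\<close>

lemma sum_eq_0_if_real_span:
  fixes c :: "'i \<Rightarrow> real^'m" and c0 :: "real^'m"
  assumes "finite J" and "cvec c0 \<in> vec.span ((\<lambda>j. cvec (c j)) ` J)"
  obtains b :: "'i \<Rightarrow> real" where "\<And>m. c0 $ m + (\<Sum>j\<in>J. b j * c j $ m) = 0"
proof -
  obtain u where u: "cvec c0 = (\<Sum>j\<in>J. u j *s cvec (c j))"
    by (rule vec.in_span_imageE[OF assms])
  have "c0 $ m + (\<Sum>j\<in>J. - Re (u j) * c j $ m) = 0" for m
  proof -
    have "complex_of_real (c0 $ m) = (\<Sum>j\<in>J. u j * complex_of_real (c j $ m))"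
      using arg_cong[OF u, of "\<lambda>x. x $ m"] by (simp add: cvec_def)
    then have "Re (complex_of_real (c0 $ m)) = Re (\<Sum>j\<in>J. u j * complex_of_real (c j $ m))"
      by (rule arg_cong)
    then show ?thesis by (simp add: sum_negf)
  qed
  then show ?thesis by (rule that)
qed

section \<open>Support and one-step expectations of the walk\<close>

locale modulated_walk =
  fixes P :: "real^'m::finite^'m" and lam mu1 mu2 :: "'m \<Rightarrow> real"
  assumes stochastic: "stochastic_matrix P"
    and lam_pos: "\<And>m. 0 < lam m" and mu1_pos: "\<And>m. 0 < mu1 m" and mu2_pos: "\<And>m. 0 < mu2 m"
    and rates_sum: "\<And>m. lam m + mu1 m + mu2 m = 1"
begin

abbreviation W :: "'m state \<Rightarrow> 'm state pmf" where
  "W \<equiv> walk_kernel P lam mu1 mu2"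

abbreviation diag :: "'m state set" where
  "diag \<equiv> {s. fst s \<in> B_boundary}"

lemma P_nonneg: "0 \<le> P $ m $ m'"
  using stochastic by (simp add: stochastic_matrix_def)

lemma pmf_modulator: "pmf (embed_pmf (($) (P $ m))) m' = P $ m $ m'"
proof (rule pmf_embed_pmf)
  show "(\<integral>\<^sup>+x. ennreal (P $ m $ x) \<partial>count_space UNIV) = 1"
    using stochastic
    by (simp add: nn_integral_count_space_finite sum_ennreal P_nonneg stochastic_matrix_def)
qed (rule P_nonneg)

lemma increment_wf: "pmf_of_list_wf [((-1, 0), lam m), ((1, 1), mu1 m), ((0, -1), mu2 m)]"
  using lam_pos[of m] mu1_pos[of m] mu2_pos[of m] rates_sum[of m]
  by (auto simp: pmf_of_list_wf_def add.assoc)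

lemma set_increment_pmf: "set_pmf (increment_pmf lam mu1 mu2 m) \<subseteq> {(-1, 0), (1, 1), (0, -1)}"
  unfolding increment_pmf_def using set_pmf_of_list[OF increment_wf[of m]] by simp

lemma expectation_increment_pmf:
  "measure_pmf.expectation (increment_pmf lam mu1 mu2 m) f =
    lam m * f (-1, 0) + mu1 m * f (1, 1) + mu2 m * f (0, -1 :: int)"
  using set_increment_pmf[of m]
  by (subst integral_measure_pmf[of "{(-1, 0), (1, 1), (0, -1)}"])
     (auto simp: increment_pmf_def pmf_pmf_of_list[OF increment_wf])

lemma set_walk_kernel:
  "set_pmf (W (y, m)) \<subseteq> {y} \<times> UNIV \<union> (\<lambda>v. (try_move y v, m)) ` {(-1, 0), (1, 1), (0, -1)}"
  using set_increment_pmf[of m] by (auto simp: walk_kernel_def split: if_splits)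

lemma finite_walk_kernel: "finite (set_pmf (W s))"
  by (cases s) (auto intro: finite_subset[OF set_walk_kernel])

lemma expectation_walk_kernel:
  "measure_pmf.expectation (W (y, m)) h = (\<Sum>m'\<in>UNIV. P $ m $ m' *
    (if m' \<noteq> m then h (y, m') else lam m * h (try_move y (-1, 0), m) +
      mu1 m * h (try_move y (1, 1), m) + mu2 m * h (try_move y (0, -1), m)))"
proof -
  have fin: "finite (set_pmf (increment_pmf lam mu1 mu2 m))"
    by (rule finite_subset[OF set_increment_pmf]) simp
  have "measure_pmf.expectation (W (y, m)) h = (\<Sum>m'\<in>UNIV. P $ m $ m' *
    measure_pmf.expectation (if m' \<noteq> m then return_pmf (y, m')
       else map_pmf (\<lambda>v. (try_move y v, m)) (increment_pmf lam mu1 mu2 m)) h)"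
    unfolding walk_kernel_def prod.case
    by (subst pmf_expectation_bind[of UNIV]) (use fin in \<open>auto simp: pmf_modulator\<close>)
  also have "\<dots> = (\<Sum>m'\<in>UNIV. P $ m $ m' *
    (if m' \<noteq> m then h (y, m') else lam m * h (try_move y (-1, 0), m) +
      mu1 m * h (try_move y (1, 1), m) + mu2 m * h (try_move y (0, -1), m)))"
    by (intro sum.cong refl) (simp add: expectation_increment_pmf)
  finally show ?thesis .
qed

text \<open>Each transition multiplies the position factor \<open>t\<close> by a constant, and these
  constants make up \<open>char_matrix\<close>. At \<open>y2 = 0\<close> the blocked downward move
  has factor 1 instead of \<open>\<beta> / \<alpha>\<close>, which produces the boundary
  term.\<close>

lemma expectation_expfun:
  assumes "0 < \<beta>" "0 < \<alpha>" and d: "char_matrix P lam mu1 mu2 \<beta> \<alpha> *v d = d"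
  shows "measure_pmf.expectation (W ((y1, y2), m)) (expfun \<beta> \<alpha> d) = expfun \<beta> \<alpha> d ((y1, y2), m) +
    (if y2 = 0 then \<beta> powi y1 * (P $ m $ m * mu2 m * d $ m * (1 - \<beta> / \<alpha>)) else 0)"
proof -
  define t where "t = \<beta> powi (y1 - int y2) * \<alpha> ^ y2"
  let ?c = "if y2 = 0 then \<beta> powi y1 * (P $ m $ m * mu2 m * d $ m * (1 - \<beta> / \<alpha>)) else 0"
  have left: "expfun \<beta> \<alpha> d (try_move (y1, y2) (-1, 0), m) = t * (d $ m / \<beta>)"
    using assms(1) power_int_diff[of \<beta> "y1 - int y2" 1] by (simp add: expfun_def t_def algebra_simps)
  have up: "expfun \<beta> \<alpha> d (try_move (y1, y2) (1, 1), m) = t * (\<alpha> * d $ m)"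
    by (simp add: expfun_def t_def nat_add_distrib algebra_simps)
  have down: "expfun \<beta> \<alpha> d (try_move (y1, y2) (0, -1), m) =
      t * ((if y2 = 0 then 1 else \<beta> / \<alpha>) * d $ m)"
  proof (cases y2)
    case (Suc k)
    have "\<beta> powi (y1 - int k) = \<beta> powi (y1 - int y2) * \<beta>"
      using assms(1) power_int_add_1[of \<beta> "y1 - int y2"] by (simp add: Suc)
    then show ?thesis using Suc assms(1,2) by (simp add: expfun_def t_def)
  qed (simp add: expfun_def t_def)
  have "measure_pmf.expectation (W ((y1, y2), m)) (expfun \<beta> \<alpha> d) =
      (\<Sum>m'\<in>UNIV. t * (char_matrix P lam mu1 mu2 \<beta> \<alpha> $ m $ m' * d $ m') + (if m' = m then ?c else 0))"
    unfolding expectation_walk_kernel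
  proof (intro sum.cong refl)
    fix m'
    show "P $ m $ m' * (if m' \<noteq> m then expfun \<beta> \<alpha> d ((y1, y2), m') else
        lam m * expfun \<beta> \<alpha> d (try_move (y1, y2) (-1, 0), m) +
        mu1 m * expfun \<beta> \<alpha> d (try_move (y1, y2) (1, 1), m) +
        mu2 m * expfun \<beta> \<alpha> d (try_move (y1, y2) (0, -1), m)) =
      t * (char_matrix P lam mu1 mu2 \<beta> \<alpha> $ m $ m' * d $ m') + (if m' = m then ?c else 0)"
      unfolding left up down
      by (auto simp: char_matrix_def expfun_def t_def field_simps)
  qed
  also have "\<dots> = t * (char_matrix P lam mu1 mu2 \<beta> \<alpha> *v d) $ m + ?c"
    by (simp only: sum.distrib sum_distrib_left[symmetric] matrix_vector_mult_def vec_lambda_beta)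
       simp
  also have "t * (char_matrix P lam mu1 mu2 \<beta> \<alpha> *v d) $ m = expfun \<beta> \<alpha> d ((y1, y2), m)"
    unfolding d by (simp add: expfun_def t_def)
  finally show ?thesis .
qed

text \<open>Every transition changes \<open>y1 - y2\<close> by at most 1, so a positive difference
  stays nonnegative.\<close>

lemma walk_stays_in_B:
  assumes "y \<in> B_region" "y \<notin> B_boundary"
  shows "set_pmf (W (y, m)) \<subseteq> {s. fst s \<in> B_region}"
proof -
  obtain y1 y2 where "y = (y1, y2)" by force
  then show ?thesis
    using set_walk_kernel[of y m] assms by (auto simp: B_region_def B_boundary_def split: if_splits)
qed

section \<open>Lower bounds for the probability of hitting the diagonal\<close>

lemma hit_prob_Suc_walk:
  assumes "y \<notin> B_boundary"
  shows "hit_prob W diag (Suc n) (y, m) = (\<Sum>m'\<in>UNIV. P $ m $ m' *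
    (if m' \<noteq> m then hit_prob W diag n (y, m') else lam m * hit_prob W diag n (try_move y (-1, 0), m) +
      mu1 m * hit_prob W diag n (try_move y (1, 1), m) + mu2 m * hit_prob W diag n (try_move y (0, -1), m)))"
  using assms by (simp add: expectation_walk_kernel)

text \<open>All summands of the first-step expansion are nonnegative, so a single one can be
  kept.\<close>

lemma hit_prob_ge_modulator_step:
  assumes "y \<notin> B_boundary" "m' \<noteq> m"
  shows "P $ m $ m' * hit_prob W diag n (y, m') \<le> hit_prob W diag (Suc n) (y, m)"
  unfolding hit_prob_Suc_walk[OF assms(1)]
  by (rule order_trans[OF _ member_le_sum[of m']])
     (use assms(2) in \<open>auto intro!: mult_nonneg_nonneg add_nonneg_nonneg
        simp: P_nonneg hit_prob_bounds lam_pos mu1_pos mu2_pos less_imp_le\<close>)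

lemma hit_prob_ge_left_step:
  assumes "y \<notin> B_boundary"
  shows "P $ m $ m * lam m * hit_prob W diag n (try_move y (-1, 0), m) \<le> hit_prob W diag (Suc n) (y, m)"
proof -
  have "P $ m $ m * lam m * hit_prob W diag n (try_move y (-1, 0), m) \<le>
    P $ m $ m * (lam m * hit_prob W diag n (try_move y (-1, 0), m) +
      mu1 m * hit_prob W diag n (try_move y (1, 1), m) + mu2 m * hit_prob W diag n (try_move y (0, -1), m))"
    unfolding mult.assoc
    by (intro mult_left_mono) (simp_all add: P_nonneg hit_prob_bounds mu1_pos mu2_pos less_imp_le)
  also have "\<dots> \<le> hit_prob W diag (Suc n) (y, m)"
    unfolding hit_prob_Suc_walk[OF assms]
    by (rule order_trans[OF _ member_le_sum[of m]])
       (auto intro!: mult_nonneg_nonneg add_nonneg_nonneg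
          simp: P_nonneg hit_prob_bounds lam_pos mu1_pos mu2_pos less_imp_le)
  finally show ?thesis .
qed

text \<open>While the modulator changes state, the position stands still; hence the bound is uniform in
  the position.\<close>

lemma hit_prob_ge_modulator_path:
  assumes "0 < matrix_pow P k $ m $ m0"
  shows "\<exists>i c. 0 < c \<and> (\<forall>y n. y \<notin> B_boundary \<longrightarrow>
    c * hit_prob W diag n (y, m0) \<le> hit_prob W diag (i + n) (y, m))"
  using assms
proof (induction k arbitrary: m)
  case 0
  then have "m = m0" by (simp add: matrix_pow_def mat_def split: if_splits)
  then show ?case by (intro exI[of _ 0] exI[of _ 1]) simp
next
  case (Suc k)
  have "matrix_pow P (Suc k) $ m $ m0 = (\<Sum>m'\<in>UNIV. P $ m $ m' * matrix_pow P k $ m' $ m0)"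
    by (simp add: matrix_pow_def matrix_matrix_mult_def)
  then obtain m' where "0 < P $ m $ m' * matrix_pow P k $ m' $ m0"
    using Suc.prems by (metis (no_types, lifting) linorder_not_less sum_nonpos)
  then have m': "0 < P $ m $ m'" "0 < matrix_pow P k $ m' $ m0"
    using P_nonneg[of m m'] by (auto simp: zero_less_mult_iff)
  obtain i c where c: "0 < c" and ic: "\<And>y n. y \<notin> B_boundary \<Longrightarrow>
      c * hit_prob W diag n (y, m0) \<le> hit_prob W diag (i + n) (y, m')"
    using Suc.IH[OF m'(2)] by blast
  show ?case
  proof (cases "m' = m")
    \<comment> \<open>A self-loop of the modulator would let the walk attempt a move, so it is cut
      out of the path; hence \<open>i\<close> can be smaller than \<open>k\<close>.\<close>
    case True
    then show ?thesis using c ic by blast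
  next
    case False
    show ?thesis
    proof (intro exI[of _ "Suc i"] exI[of _ "P $ m $ m' * c"] conjI allI impI)
      fix y :: "int \<times> nat" and n assume y: "y \<notin> B_boundary"
      have "P $ m $ m' * c * hit_prob W diag n (y, m0) \<le> P $ m $ m' * hit_prob W diag (i + n) (y, m')"
        using ic[OF y] m'(1) by (simp add: mult.assoc)
      also have "\<dots> \<le> hit_prob W diag (Suc (i + n)) (y, m)"
        by (rule hit_prob_ge_modulator_step[OF y False])
      finally show "P $ m $ m' * c * hit_prob W diag n (y, m0) \<le> hit_prob W diag (Suc i + n) (y, m)"
        by simp
    qed (use c m' in simp)
  qed
qed

text \<open>Repeat the left move with the modulator fixed: each one has probability
  \<open>P $ m $ m * lam m\<close> and lowers the distance to the diagonal by 1.\<close>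

lemma hit_prob_ge_left_path:
  "(P $ m $ m * lam m) ^ n \<le> hit_prob W diag n ((int y2 + int n, y2), m)"
proof (induction n)
  case 0
  then show ?case by (simp add: B_boundary_def)
next
  case (Suc n)
  have y: "(int y2 + int (Suc n), y2) \<notin> B_boundary" by (simp add: B_boundary_def)
  have "(P $ m $ m * lam m) ^ Suc n \<le> P $ m $ m * lam m * hit_prob W diag n ((int y2 + int n, y2), m)"
    using Suc.IH P_nonneg[of m m] lam_pos[of m] by (simp add: mult_left_mono)
  also have "\<dots> \<le> hit_prob W diag (Suc n) ((int y2 + int (Suc n), y2), m)"
    using hit_prob_ge_left_step[OF y, of m n] by simp
  finally show ?case .
qed

text \<open>First bring the modulator to \<open>m0\<close> while the position stands still, then go
  left to the diagonal. Left moves require the modulator to stay, hence the positive diagonal entry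
  at \<open>m0\<close>.\<close>

lemma hit_prob_uniformly_positive:
  assumes irr: "irreducible_matrix P" and m0: "0 < P $ m0 $ m0"
  obtains N \<delta> where "0 < \<delta>" and "\<And>y m. y \<in> B_region \<Longrightarrow> y \<notin> B_boundary \<Longrightarrow>
    fst y - int (snd y) \<le> int k \<Longrightarrow> \<delta> \<le> hit_prob W diag N (y, m)"
proof -
  have "\<forall>m. \<exists>i c. 0 < c \<and> (\<forall>y n. y \<notin> B_boundary \<longrightarrow>
      c * hit_prob W diag n (y, m0) \<le> hit_prob W diag (i + n) (y, m))"
  proof
    fix m
    obtain k' where "0 < matrix_pow P k' $ m $ m0"
      using irr by (auto simp: irreducible_matrix_def)
    then show "\<exists>i c. 0 < c \<and> (\<forall>y n. y \<notin> B_boundary \<longrightarrow>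
        c * hit_prob W diag n (y, m0) \<le> hit_prob W diag (i + n) (y, m))"
      by (rule hit_prob_ge_modulator_path)
  qed
  then obtain i c where c: "\<And>m. 0 < c m" and ic: "\<And>m y n. y \<notin> B_boundary \<Longrightarrow>
      c m * hit_prob W diag n (y, m0) \<le> hit_prob W diag (i m + n) (y, m)"
    by metis
  define q where "q = P $ m0 $ m0 * lam m0"
  have "P $ m0 $ m0 \<le> (\<Sum>m'\<in>UNIV. P $ m0 $ m')"
    by (rule member_le_sum) (auto simp: P_nonneg)
  then have P1: "P $ m0 $ m0 \<le> 1" using stochastic by (simp add: stochastic_matrix_def)
  have lam1: "lam m0 \<le> 1"
    using rates_sum[of m0] mu1_pos[of m0] mu2_pos[of m0] by linarith
  have q: "0 < q" "q \<le> 1"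
    using m0 lam_pos[of m0] P1 lam1 by (auto simp: q_def intro: mult_le_one)
  show ?thesis
  proof
    \<comment> \<open>Worst case over the finitely many modulator states and over distances up to
      \<open>k\<close>: smallest \<open>c\<close>, and \<open>q ^ k \<le> q ^ n\<close> as
      \<open>q \<le> 1\<close>. The number of steps is likewise
      \<open>Max (range i) + k\<close>.\<close>
    show "0 < Min (range c) * q ^ k"
      using c q by simp
    fix y :: "int \<times> nat" and m
    assume y: "y \<in> B_region" "y \<notin> B_boundary" "fst y - int (snd y) \<le> int k"
    define n where "n = nat (fst y - int (snd y))"
    have y_eq: "y = (int (snd y) + int n, snd y)"
      using y(1) by (simp add: n_def B_region_def prod_eq_iff)
    have "n \<le> k" using y(3) by (simp add: n_def)
    have "Min (range c) * q ^ k \<le> c m * q ^ n"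
      using q c[of m] \<open>n \<le> k\<close> by (intro mult_mono) (auto intro: power_decreasing)
    also have "q ^ n \<le> hit_prob W diag n (y, m0)"
      using hit_prob_ge_left_path[of m0 n "snd y"] by (simp add: q_def flip: y_eq)
    then have "c m * q ^ n \<le> c m * hit_prob W diag n (y, m0)"
      using c[of m] by simp
    also have "\<dots> \<le> hit_prob W diag (i m + n) (y, m)"
      by (rule ic[OF y(2)])
    also have "\<dots> \<le> hit_prob W diag (Max (range i) + k) (y, m)"
      using \<open>n \<le> k\<close> by (intro hit_prob_mono add_mono) auto
    finally show "Min (range c) * q ^ k \<le> hit_prob W diag (Max (range i) + k) (y, m)" .
  qed
qed

text \<open>By the geometric decay, \<open>\<bar>h\<bar> \<ge> e\<close> on \<open>B\<close>
  confines the walk to a strip around the diagonal, where hitting is uniformly likely; this is what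
  optional stopping asks for.\<close>

lemma boundary_determinedI:
  assumes irr: "irreducible_matrix P" and m0: "0 < P $ m0 $ m0"
    and mean: "\<And>s. measure_pmf.expectation (W s) h = h s"
    and r: "0 \<le> r" "r < 1"
    and bound: "\<And>y1 y2 m. int y2 \<le> y1 \<Longrightarrow> \<bar>h ((y1, y2), m)\<bar> \<le> C * r ^ nat (y1 - int y2)"
  shows "boundary_determined W h"
  unfolding boundary_determined_def
proof (intro exI allI impI)
  fix y :: "int \<times> nat" and m assume y: "y \<in> B_region"
  let ?R = "{s :: 'm state. fst s \<in> B_region}"
  \<comment> \<open>Off \<open>B\<close> no bound on \<open>h\<close> is available, while optional
    stopping needs one on all states. Cutting \<open>h\<close> off outside \<open>B\<close> changes
    no value seen up to the hitting time.\<close>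
  let ?f = "\<lambda>s. indicator ?R s * h s"
  have C: "0 \<le> C"
    using bound[of 0 0 m] by simp
  have f_bd: "\<bar>?f s\<bar> \<le> C" for s
  proof (cases "s \<in> ?R")
    case True
    obtain y1 y2 m where s: "s = ((y1, y2), m)" by (metis prod.collapse)
    have "\<bar>h s\<bar> \<le> C * r ^ nat (y1 - int y2)"
      using bound[of y2 y1 m] True by (simp add: s B_region_def)
    also have "\<dots> \<le> C"
      using C r by (intro mult_left_le) (simp_all add: power_le_one)
    finally show ?thesis using True by simp
  qed (use C in simp)
  have closed: "set_pmf (W s) \<subseteq> ?R" if "s \<in> ?R - diag" for s
    using walk_stays_in_B[of "fst s" "snd s"] that by simp
  have f_mean: "measure_pmf.expectation (W s) ?f = ?f s" if "s \<in> ?R - diag" for s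
  proof -
    have "measure_pmf.expectation (W s) ?f = measure_pmf.expectation (W s) h"
      using closed[OF that] by (intro integral_cong_AE) (auto simp: AE_measure_pmf_iff)
    then show ?thesis using mean that by simp
  qed
  have hit: "\<exists>N \<delta>. 0 < \<delta> \<and> (\<forall>s\<in>?R - diag. e \<le> \<bar>?f s\<bar> \<longrightarrow> \<delta> \<le> hit_prob W diag N s)"
    if e: "0 < e" for e
  proof -
    have "(\<lambda>k. C * r ^ k) \<longlonglongrightarrow> C * 0"
      using r by (intro tendsto_mult_left LIMSEQ_power_zero) simp
    then have "eventually (\<lambda>k. C * r ^ k < e) sequentially"
      using e by (intro order_tendstoD(2)) auto
    then obtain k where k: "C * r ^ k < e"
      by (auto simp: eventually_sequentially)
    obtain N \<delta> where \<delta>: "0 < \<delta>" and N: "\<And>y m. y \<in> B_region \<Longrightarrow> y \<notin> B_boundary \<Longrightarrow>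
        fst y - int (snd y) \<le> int k \<Longrightarrow> \<delta> \<le> hit_prob W diag N (y, m)"
      by (rule hit_prob_uniformly_positive[OF irr m0, of k]) (rule that)
    have "\<delta> \<le> hit_prob W diag N s" if s: "s \<in> ?R - diag" "e \<le> \<bar>?f s\<bar>" for s
    proof -
      obtain y1 y2 m where s_eq: "s = ((y1, y2), m)" by (metis prod.collapse)
      have "y1 - int y2 \<le> int k"
      proof (rule ccontr)
        assume "\<not> y1 - int y2 \<le> int k"
        then have "r ^ nat (y1 - int y2) \<le> r ^ k"
          using r by (intro power_decreasing) auto
        then have "C * r ^ nat (y1 - int y2) < e"
          using k C by (meson mult_left_mono order_le_less_trans)
        then show False
          using s bound[of y2 y1 m] by (simp add: s_eq B_region_def)
      qed
      then show ?thesis using N[of "(y1, y2)" m] s by (simp add: s_eq)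
    qed
    then show ?thesis using \<delta> by blast
  qed
  have ym: "(y, m) \<in> ?R" using y by simp
  note * = expectation_at_hitting_time[of ?f C ?R diag W, OF f_bd closed ym f_mean hit]
  show "let g = \<lambda>\<omega>. ?f (\<omega> (the_enat (hit_time \<omega>))) * indicator {\<omega>. hit_time \<omega> < \<infinity>} \<omega>
      in integrable (path_measure W (y, m)) g \<and> h (y, m) = (\<integral>\<omega>. g \<omega> \<partial>path_measure W (y, m))"
    using * y by (simp add: hit_time_def)
qed

end

section \<open>Harmonicity and decay of the combined exponentials\<close>

theorem proposition7p1:
  fixes P :: "real^'m^'m" and p :: "real^'m"
    and lam mu1 mu2 :: "'m::finite \<Rightarrow> real"
    and \<rho>1 \<rho>2 :: real and d2 :: "real^'m"
    and \<alpha> :: "nat \<Rightarrow> real" and d2j :: "nat \<Rightarrow> real^'m"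
  assumes "stochastic_matrix P" and "irreducible_matrix P" and "aperiodic_matrix P"
    and "stationary_distribution P p"
    and "\<And>m. lam m > 0" and "\<And>m. mu1 m > 0" and "\<And>m. mu2 m > 0"
    and "\<And>m. lam m + mu1 m + mu2 m = 1"
    and "stability_condition P p lam mu1 mu2"
    and "0 < \<rho>1" and "\<rho>1 < 1" and "Lambda 1 P lam mu1 mu2 \<rho>1 \<rho>1 = 1"
    and "0 < \<rho>2" and "\<rho>2 < 1" and "Lambda 1 P lam mu1 mu2 \<rho>2 1 = 1"
    and "\<And>m. d2 $ m > 0" and "char_matrix P lam mu1 mu2 \<rho>2 1 *v d2 = d2"
    and "determinant_condition P lam mu1 mu2 \<rho>2"
    and "\<rho>1 \<noteq> \<rho>2"
    and "distinct_real_eigenvalues P lam mu1 mu2"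
    and "0 < \<alpha> 1" and "\<alpha> 1 < 1" and "Lambda 1 P lam mu1 mu2 \<rho>2 (\<alpha> 1) = 1"
    and "\<And>j. j \<in> {2..CARD('m)} \<Longrightarrow>
           0 < \<alpha> j \<and> \<alpha> j < \<alpha> 1 \<and> Lambda j P lam mu1 mu2 \<rho>2 (\<alpha> j) = 1"
    and "\<And>j. j \<in> {1..CARD('m)} \<Longrightarrow>
           d2j j \<noteq> 0 \<and> char_matrix P lam mu1 mu2 \<rho>2 (\<alpha> j) *v d2j j = d2j j"
    and "boundary_vec P mu2 (of_real \<rho>2) 1 (cvec d2) \<in>
           vec.span ((\<lambda>j. boundary_vec P mu2 (of_real \<rho>2) (of_real (\<alpha> j)) (cvec (d2j j)))
                      ` {1..CARD('m)})"
  shows "\<exists>b :: nat \<Rightarrow> real.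
           let h = (\<lambda>s. expfun \<rho>2 1 d2 s + (\<Sum>j = 1..CARD('m). b j * expfun \<rho>2 (\<alpha> j) (d2j j) s))
           in harmonic (walk_kernel P lam mu1 mu2) h \<and>
              boundary_determined (walk_kernel P lam mu1 mu2) h"
proof -
  interpret modulated_walk P lam mu1 mu2
    by standard (fact assms)+
  let ?J = "{1..CARD('m)}"
  have \<alpha>_range: "0 < \<alpha> j \<and> \<alpha> j \<le> 1" if "j \<in> ?J" for j
  proof (cases "j = 1")
    case False
    then have "j \<in> {2..CARD('m)}" using that by auto
    then show ?thesis using assms(24)[of j] assms(22) by simp
  qed (use assms(21,22) in simp)
  \<comment> \<open>The real counterpart of \<open>boundary_vec\<close>, needed because the span
    condition is over the complex numbers.\<close>
  define c where "c \<beta> \<alpha> d = (\<chi> m. P $ m $ m * mu2 m * d $ m * (1 - \<beta> / \<alpha>))"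
    for \<beta> \<alpha> :: real and d :: "real^'m"
  have bv: "boundary_vec P mu2 (of_real \<beta>) (of_real a) (cvec d) = cvec (c \<beta> a d)" for \<beta> a d
    by (simp add: boundary_vec_def cvec_def c_def vec_eq_iff)
  have c_span: "cvec (c \<rho>2 1 d2) \<in> vec.span ((\<lambda>j. cvec (c \<rho>2 (\<alpha> j) (d2j j))) ` ?J)"
    using assms(26) bv[of \<rho>2 1 d2] by (simp add: bv)
  obtain b where b: "\<And>m. c \<rho>2 1 d2 $ m + (\<Sum>j\<in>?J. b j * c \<rho>2 (\<alpha> j) (d2j j) $ m) = 0"
    by (rule sum_eq_0_if_real_span[OF finite_atLeastAtMost c_span]) (rule that)
  define h where "h s = expfun \<rho>2 1 d2 s + (\<Sum>j\<in>?J. b j * expfun \<rho>2 (\<alpha> j) (d2j j) s)" for s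
  have int: "integrable (measure_pmf (W s)) f" for s and f :: "'m state \<Rightarrow> real"
    by (intro integrable_measure_pmf_finite finite_walk_kernel)
  have mean: "measure_pmf.expectation (W s) h = h s" for s
  proof -
    obtain y1 y2 m where s: "s = ((y1, y2), m)" by (metis prod.collapse)
    \<comment> \<open>All terms share \<beta> = \<open>\<rho>2\<close>, so their defects share the
      factor \<open>?k\<close>, and one relation between the boundary vectors cancels them at every
      boundary point.\<close>
    let ?k = "if y2 = 0 then \<rho>2 powi y1 else 0"
    have E: "measure_pmf.expectation (W s) (expfun \<rho>2 a d) = expfun \<rho>2 a d s + ?k * c \<rho>2 a d $ m"
      if "0 < a" "char_matrix P lam mu1 mu2 \<rho>2 a *v d = d" for a d
      using expectation_expfun[OF assms(13) that, of y1 y2 m] by (simp add: s c_def)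
    have "measure_pmf.expectation (W s) h = measure_pmf.expectation (W s) (expfun \<rho>2 1 d2) +
        (\<Sum>j\<in>?J. b j * measure_pmf.expectation (W s) (expfun \<rho>2 (\<alpha> j) (d2j j)))"
      unfolding h_def[abs_def]
      by (simp add: Bochner_Integration.integral_sum int)
    also have "\<dots> = expfun \<rho>2 1 d2 s + ?k * c \<rho>2 1 d2 $ m +
        (\<Sum>j\<in>?J. b j * (expfun \<rho>2 (\<alpha> j) (d2j j) s + ?k * c \<rho>2 (\<alpha> j) (d2j j) $ m))"
      using assms(17,25) \<alpha>_range by (intro arg_cong2[of _ _ _ _ "(+)"] sum.cong) (auto simp: E)
    also have "\<dots> = h s + ?k * (c \<rho>2 1 d2 $ m + (\<Sum>j\<in>?J. b j * c \<rho>2 (\<alpha> j) (d2j j) $ m))"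
      by (simp add: h_def distrib_left sum.distrib sum_distrib_left mult.left_commute)
    finally show ?thesis by (simp only: b mult_zero_right add_0_right)
  qed
  \<comment> \<open>If all diagonal entries of \<open>P\<close> were 0, the sums in the stability
    condition would be 0 rather than negative.\<close>
  obtain m0 where "0 < P $ m0 $ m0"
  proof -
    have "\<exists>m\<in>UNIV. (lam m - mu1 m) * p $ m * P $ m $ m \<noteq> 0"
      using assms(9) sum.neutral[of UNIV "\<lambda>m. (lam m - mu1 m) * p $ m * P $ m $ m"]
      by (auto simp: stability_condition_def)
    then obtain m where "P $ m $ m \<noteq> 0" by auto
    then show ?thesis using P_nonneg[of m m] that[of m] by simp
  qed
  \<comment> \<open>Summing over all \<open>m\<close> gives one constant for every modulator
    state.\<close>
  define C where "C = (\<Sum>m\<in>UNIV. \<bar>d2 $ m\<bar> + (\<Sum>j\<in>?J. \<bar>b j\<bar> * \<bar>d2j j $ m\<bar>))"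
  have "\<bar>h ((y1, y2), m)\<bar> \<le> C * \<rho>2 ^ nat (y1 - int y2)" if "int y2 \<le> y1" for y1 y2 m
  proof -
    let ?r = "\<rho>2 ^ nat (y1 - int y2)"
    have e: "\<bar>expfun \<rho>2 a d ((y1, y2), m)\<bar> \<le> \<bar>d $ m\<bar> * ?r" if a: "0 < a" "a \<le> 1" for a and d :: "real^'m"
    proof -
      have "\<bar>expfun \<rho>2 a d ((y1, y2), m)\<bar> = a ^ y2 * (\<bar>d $ m\<bar> * ?r)"
        using a assms(13) \<open>int y2 \<le> y1\<close> by (simp add: expfun_def abs_mult power_int_def)
      also have "\<dots> \<le> \<bar>d $ m\<bar> * ?r"
        using a assms(13) by (intro mult_left_le_one_le) (auto intro: power_le_one)
      finally show ?thesis .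
    qed
    have "\<bar>h ((y1, y2), m)\<bar> \<le> \<bar>expfun \<rho>2 1 d2 ((y1, y2), m)\<bar> +
        (\<Sum>j\<in>?J. \<bar>b j\<bar> * \<bar>expfun \<rho>2 (\<alpha> j) (d2j j) ((y1, y2), m)\<bar>)"
      unfolding h_def
      by (rule order_trans[OF abs_triangle_ineq add_left_mono])
         (rule order_trans[OF sum_abs], simp add: abs_mult)
    also have "\<dots> \<le> \<bar>d2 $ m\<bar> * ?r + (\<Sum>j\<in>?J. \<bar>b j\<bar> * (\<bar>d2j j $ m\<bar> * ?r))"
      using \<alpha>_range by (intro add_mono sum_mono mult_left_mono e) auto
    also have "\<dots> = (\<bar>d2 $ m\<bar> + (\<Sum>j\<in>?J. \<bar>b j\<bar> * \<bar>d2j j $ m\<bar>)) * ?r"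
      by (simp add: distrib_right sum_distrib_right mult.assoc)
    also have "\<dots> \<le> C * ?r"
    proof (rule mult_right_mono)
      show "\<bar>d2 $ m\<bar> + (\<Sum>j\<in>?J. \<bar>b j\<bar> * \<bar>d2j j $ m\<bar>) \<le> C"
        unfolding C_def
        by (rule member_le_sum[of m UNIV "\<lambda>m. \<bar>d2 $ m\<bar> + (\<Sum>j\<in>?J. \<bar>b j\<bar> * \<bar>d2j j $ m\<bar>)"])
           (auto intro!: add_nonneg_nonneg sum_nonneg)
    qed (use assms(13) in simp)
    finally show ?thesis .
  qed
  then have "boundary_determined W h"
    using boundary_determinedI[OF assms(2) \<open>0 < P $ m0 $ m0\<close> mean, of \<rho>2 C] assms(13,14) by simp
  moreover have "harmonic W h"
    by (rule harmonicI[OF finite_walk_kernel mean])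
  ultimately show ?thesis
    unfolding h_def[abs_def] by (intro exI[of _ b]) (simp only: Let_def)
qed

end
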